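(* Let $\mathsf{A}$ be an abelian category, let $\mathrm{F}$ be a contravariant additive functor from $\mathsf{A}$ to the category $\mathsf{Ab}$ of abelian groups, and let $\mathsf{V}$ be a special preenveloping subcategory of $\mathsf{A}$. If $\mathrm{F}$ is half $\operatorname{Hom}_{\mathsf{A}}(-,\mathsf{V})$-exact, then so is the $\mathsf{V}$-stable functor $\overline{\mathrm{F}}^{\mathsf{V}}$, and the following statements are equivalent: (i) $\overline{\mathrm{F}}^{\mathsf{V}}$ is right $\operatorname{Hom}_{\mathsf{A}}(-,\mathsf{V})$-exact. (ii) $\overline{\mathrm{F}}^{\mathsf{V}}=0$. (iii) $\mathrm{F}$ is right $\operatorname{Hom}_{\mathsf{A}}(-,\mathsf{V})$-exact. Moreover, if $\mathrm{F}$ is left $\operatorname{Hom}_{\mathsf{A}}(-,\mathsf{V})$-exact, then the following statements are equivalent: (i) $\overline{\mathrm{F}}^{\mathsf{V}}$ is left $\operatorname{Hom}_{\mathsf{A}}(-,\mathsf{V})$-exact. (ii) $\overline{\mathrm{F}}^{\mathsf{V}}(\mathsf{\Theta}_{\mathsf{V}}^{i}M)=0$ for each object $M$ in $\mathsf{A}$ and all $i\geq 1$. (iii) $\overline{\mathrm{F}}^{\mathsf{V}}(\mathsf{\Theta}_{\mathsf{V}}M)=0$ for each object $M$ in $\mathsf{A}$.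
   Context: "Subcategory" means a full additive subcategory closed under isomorphisms. For a subcategory $\mathsf{X}$ of $\mathsf{A}$, ${}^{\perp}\mathsf{X}=\{M \mid \operatorname{Ext}^1_{\mathsf{A}}(M,X)=0\text{ for all }X\in\mathsf{X}\}$ (Yoneda Ext). A special $\mathsf{X}$-preenvelope of $M$ is an exact sequence $0\to M\to X\to C\to 0$ with $X\in\mathsf{X}$ and $C\in{}^{\perp}\mathsf{X}$; $\mathsf{X}$ is special preenveloping if every object of $\mathsf{A}$ has a special $\mathsf{X}$-preenvelope. A sequence in $\mathsf{A}$ is $\operatorname{Hom}_{\mathsf{A}}(-,\mathsf{V})$-exact if it stays exact after applying $\operatorname{Hom}_{\mathsf{A}}(-,V)$ for every $V\in\mathsf{V}$. A proper $\mathsf{V}$-coresolution of $M$ is a complex $I$ of objects in $\mathsf{V}$ with $I^{-n}=0=\mathrm{H}^n(I)$ for all $n>0$ and $\mathrm{H}^0(I)\cong M$, such that the associated exact sequence $0\to M\to I^0\to I^1\to\cdots$ is $\operatorname{Hom}_{\mathsf{A}}(-,\mathsf{V})$-exact. It is special if $\operatorname{Ker}(I^i\to I^{i+1})\in{}^{\perp}\mathsf{V}$ for all $i\ge1$; every object has a special proper $\mathsf{V}$-coresolution. $\mathsf{\Theta}^i_{\mathsf{V}}M$ denotes $\operatorname{Ker}(I^i\to I^{i+1})$ for some special proper $\mathsf{V}$-coresolution $I$ of $M$ (the $i$th $\mathsf{V}$-cosyzygy), and $\mathsf{\Theta}_{\mathsf{V}}M=\mathsf{\Theta}^1_{\mathsf{V}}M$.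 $\mathsf{V}$-stable functor: for a proper $\mathsf{V}$-coresolution $I$ of $M$, with augmentation $d\colon M\to I^0$, put $\mathrm{L}^{\mathsf{V}}_0\mathrm{F}(M)=\mathrm{H}_0(\mathrm{F}(I))=\operatorname{Coker}(\mathrm{F}(I^1)\to\mathrm{F}(I^0))$. The map $\mathrm{F}(d)$ induces a natural transformation $\rho\colon\mathrm{L}_0^{\mathsf{V}}\mathrm{F}\to\mathrm{F}$, and $\overline{\mathrm{F}}^{\mathsf{V}}=\operatorname{Coker}\rho$. It is a contravariant additive functor, independent (up to isomorphism) of the choice of proper $\mathsf{V}$-coresolutions. A contravariant additive functor $\mathrm{F}$ is half (resp. left, right) $\operatorname{Hom}_{\mathsf{A}}(-,\mathsf{V})$-exact if for each $\operatorname{Hom}_{\mathsf{A}}(-,\mathsf{V})$-exact short exact sequence $0\to A'\to A\to A''\to0$ in $\mathsf{A}$ the sequence $\mathrm{F}(A'')\to\mathrm{F}(A)\to\mathrm{F}(A')$ (resp. $0\to\mathrm{F}(A'')\to\mathrm{F}(A)\to\mathrm{F}(A')$, resp. $\mathrm{F}(A'')\to\mathrm{F}(A)\to\mathrm{F}(A')\to0$) is exact. *)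

theory Defs
  imports "HOL-Algebra.Exact_Sequence"
begin

section \<open>Abelian categories\<close>

text \<open>
  Categories are carrier-based, in the style of \<^theory>\<open>HOL-Algebra.Group\<close>: objects and arrows form
  subsets of two arbitrary types, and every arrow has one domain and one codomain. Arrows are
  composed as functions are: \<open>g \<cdot> f\<close> is \<open>f\<close> followed by \<open>g\<close>.
\<close>

record ('o, 'm) precategory =
  Obj :: "'o set"
  Arr :: "'m set"
  Dom :: "'m \<Rightarrow> 'o"
  Cod :: "'m \<Rightarrow> 'o"
  Ident :: "'o \<Rightarrow> 'm"
  Comp :: "'m \<Rightarrow> 'm \<Rightarrow> 'm" (infixl \<open>\<cdot>\<index>\<close> 70)
  Plus :: "'m \<Rightarrow> 'm \<Rightarrow> 'm"
  Zero :: "'o \<Rightarrow> 'o \<Rightarrow> 'm"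

definition Hom :: "('o, 'm) precategory \<Rightarrow> 'o \<Rightarrow> 'o \<Rightarrow> 'm set" where
  "Hom A X Y = {f \<in> Arr A. Dom A f = X \<and> Cod A f = Y}"

definition Hom_group :: "('o, 'm) precategory \<Rightarrow> 'o \<Rightarrow> 'o \<Rightarrow> 'm monoid" where
  "Hom_group A X Y = \<lparr>carrier = Hom A X Y, mult = Plus A, one = Zero A X Y\<rparr>"

definition zero_object :: "('o, 'm) precategory \<Rightarrow> 'o \<Rightarrow> bool" where
  "zero_object A Z \<longleftrightarrow> Z \<in> Obj A \<and>
     (\<forall>X\<in>Obj A. (\<exists>!f. f \<in> Hom A Z X) \<and> (\<exists>!f. f \<in> Hom A X Z))"

definition biproduct :: "('o, 'm) precategory \<Rightarrow> 'o \<Rightarrow> 'o \<Rightarrow> 'o \<Rightarrow> 'm \<Rightarrow> 'm \<Rightarrow> 'm \<Rightarrow> 'm \<Rightarrow> bool" where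
  "biproduct A X Y S i j p q \<longleftrightarrow>
     i \<in> Hom A X S \<and> j \<in> Hom A Y S \<and> p \<in> Hom A S X \<and> q \<in> Hom A S Y \<and>
     p \<cdot>\<^bsub>A\<^esub> i = Ident A X \<and> q \<cdot>\<^bsub>A\<^esub> j = Ident A Y \<and>
     p \<cdot>\<^bsub>A\<^esub> j = Zero A Y X \<and> q \<cdot>\<^bsub>A\<^esub> i = Zero A X Y \<and>
     Plus A (i \<cdot>\<^bsub>A\<^esub> p) (j \<cdot>\<^bsub>A\<^esub> q) = Ident A S"

definition isomorphic :: "('o, 'm) precategory \<Rightarrow> 'o \<Rightarrow> 'o \<Rightarrow> bool" where
  "isomorphic A X Y \<longleftrightarrow>
     (\<exists>f\<in>Hom A X Y. \<exists>g\<in>Hom A Y X. g \<cdot>\<^bsub>A\<^esub> f = Ident A X \<and> f \<cdot>\<^bsub>A\<^esub> g = Ident A Y)"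

definition mono_arr :: "('o, 'm) precategory \<Rightarrow> 'm \<Rightarrow> bool" where
  "mono_arr A f \<longleftrightarrow> f \<in> Arr A \<and>
     (\<forall>X. \<forall>g\<in>Hom A X (Dom A f). \<forall>h\<in>Hom A X (Dom A f). f \<cdot>\<^bsub>A\<^esub> g = f \<cdot>\<^bsub>A\<^esub> h \<longrightarrow> g = h)"

definition epi_arr :: "('o, 'm) precategory \<Rightarrow> 'm \<Rightarrow> bool" where
  "epi_arr A f \<longleftrightarrow> f \<in> Arr A \<and>
     (\<forall>X. \<forall>g\<in>Hom A (Cod A f) X. \<forall>h\<in>Hom A (Cod A f) X. g \<cdot>\<^bsub>A\<^esub> f = h \<cdot>\<^bsub>A\<^esub> f \<longrightarrow> g = h)"

definition kernel_arr :: "('o, 'm) precategory \<Rightarrow> 'm \<Rightarrow> 'm \<Rightarrow> bool" where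
  "kernel_arr A k f \<longleftrightarrow> f \<in> Arr A \<and> k \<in> Arr A \<and> Cod A k = Dom A f \<and>
     f \<cdot>\<^bsub>A\<^esub> k = Zero A (Dom A k) (Cod A f) \<and>
     (\<forall>X. \<forall>h\<in>Hom A X (Dom A f). f \<cdot>\<^bsub>A\<^esub> h = Zero A X (Cod A f) \<longrightarrow>
        (\<exists>!u. u \<in> Hom A X (Dom A k) \<and> k \<cdot>\<^bsub>A\<^esub> u = h))"

definition cokernel_arr :: "('o, 'm) precategory \<Rightarrow> 'm \<Rightarrow> 'm \<Rightarrow> bool" where
  "cokernel_arr A c f \<longleftrightarrow> f \<in> Arr A \<and> c \<in> Arr A \<and> Dom A c = Cod A f \<and>
     c \<cdot>\<^bsub>A\<^esub> f = Zero A (Dom A f) (Cod A c) \<and>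
     (\<forall>X. \<forall>h\<in>Hom A (Cod A f) X. h \<cdot>\<^bsub>A\<^esub> f = Zero A (Dom A f) X \<longrightarrow>
        (\<exists>!u. u \<in> Hom A (Cod A c) X \<and> u \<cdot>\<^bsub>A\<^esub> c = h))"

definition image_arr :: "('o, 'm) precategory \<Rightarrow> 'm \<Rightarrow> 'm \<Rightarrow> bool" where
  "image_arr A m f \<longleftrightarrow> (\<exists>c. cokernel_arr A c f \<and> kernel_arr A m c)"

locale preadditive_category =
  fixes A :: "('o, 'm) precategory" (structure)
  assumes Dom_closed: "f \<in> Arr A \<Longrightarrow> Dom A f \<in> Obj A"
    and Cod_closed: "f \<in> Arr A \<Longrightarrow> Cod A f \<in> Obj A"
    and Ident_closed: "X \<in> Obj A \<Longrightarrow> Ident A X \<in> Hom A X X"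
    and Comp_closed: "f \<in> Hom A X Y \<Longrightarrow> g \<in> Hom A Y Z \<Longrightarrow> g \<cdot> f \<in> Hom A X Z"
    and Comp_Ident: "f \<in> Hom A X Y \<Longrightarrow> f \<cdot> Ident A X = f"
    and Ident_Comp: "f \<in> Hom A X Y \<Longrightarrow> Ident A Y \<cdot> f = f"
    and Comp_assoc: "f \<in> Hom A X Y \<Longrightarrow> g \<in> Hom A Y Z \<Longrightarrow> h \<in> Hom A Z W \<Longrightarrow>
      h \<cdot> (g \<cdot> f) = (h \<cdot> g) \<cdot> f"
    and Hom_comm_group: "X \<in> Obj A \<Longrightarrow> Y \<in> Obj A \<Longrightarrow> comm_group (Hom_group A X Y)"
    and Comp_Plus: "f \<in> Hom A X Y \<Longrightarrow> f' \<in> Hom A X Y \<Longrightarrow> g \<in> Hom A Y Z \<Longrightarrow>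
      g \<cdot> (Plus A f f') = Plus A (g \<cdot> f) (g \<cdot> f')"
    and Plus_Comp: "f \<in> Hom A X Y \<Longrightarrow> g \<in> Hom A Y Z \<Longrightarrow> g' \<in> Hom A Y Z \<Longrightarrow>
      Plus A g g' \<cdot> f = Plus A (g \<cdot> f) (g' \<cdot> f)"

locale additive_category = preadditive_category +
  assumes zero_object_exists: "\<exists>Z. zero_object A Z"
    and biproduct_exists: "X \<in> Obj A \<Longrightarrow> Y \<in> Obj A \<Longrightarrow> \<exists>S i j p q. biproduct A X Y S i j p q"

locale abelian_category = additive_category +
  assumes kernel_exists: "f \<in> Arr A \<Longrightarrow> \<exists>k. kernel_arr A k f"
    and cokernel_exists: "f \<in> Arr A \<Longrightarrow> \<exists>c. cokernel_arr A c f"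
    and mono_is_kernel: "mono_arr A f \<Longrightarrow> \<exists>g. kernel_arr A f g"
    and epi_is_cokernel: "epi_arr A f \<Longrightarrow> \<exists>g. cokernel_arr A f g"

definition exact_at :: "('o, 'm) precategory \<Rightarrow> 'm \<Rightarrow> 'm \<Rightarrow> bool" where
  "exact_at A f g \<longleftrightarrow> (\<exists>m. image_arr A m f \<and> kernel_arr A m g)"

definition short_exact :: "('o, 'm) precategory \<Rightarrow> 'm \<Rightarrow> 'm \<Rightarrow> bool" where
  "short_exact A f g \<longleftrightarrow> mono_arr A f \<and> exact_at A f g \<and> epi_arr A g"

text \<open>A full subcategory is given by its set of objects.\<close>

definition additive_subcategory :: "('o, 'm) precategory \<Rightarrow> 'o set \<Rightarrow> bool" where
  "additive_subcategory A V \<longleftrightarrow> V \<subseteq> Obj A \<and>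
     (\<forall>X\<in>V. \<forall>Y. isomorphic A X Y \<longrightarrow> Y \<in> V) \<and>
     (\<exists>Z\<in>V. zero_object A Z) \<and>
     (\<forall>X\<in>V. \<forall>Y\<in>V. \<exists>S\<in>V. \<exists>i j p q. biproduct A X Y S i j p q)"


section \<open>Yoneda extensions\<close>

text \<open>
  An extension \<open>0 \<rightarrow> X \<rightarrow> E \<rightarrow> M \<rightarrow> 0\<close> is the pair of its two arrows. Arrows between extensions that
  fix both ends are isomorphisms by the five lemma, so \<open>ext_equiv\<close> is an equivalence relation. The
  zero element of the group \<open>Ext1 A M X\<close> under Baer sum is the class of the split extensions.
\<close>

definition extensions :: "('o, 'm) precategory \<Rightarrow> 'o \<Rightarrow> 'o \<Rightarrow> ('m \<times> 'm) set" where
  "extensions A M X = {(i, p). short_exact A i p \<and> Dom A i = X \<and> Cod A p = M}"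

definition ext_equiv :: "('o, 'm) precategory \<Rightarrow> 'o \<Rightarrow> 'o \<Rightarrow> (('m \<times> 'm) \<times> ('m \<times> 'm)) set" where
  "ext_equiv A M X = {((i, p), (i', p')).
     (i, p) \<in> extensions A M X \<and> (i', p') \<in> extensions A M X \<and>
     (\<exists>h\<in>Hom A (Cod A i) (Cod A i'). h \<cdot>\<^bsub>A\<^esub> i = i' \<and> p' \<cdot>\<^bsub>A\<^esub> h = p)}"

definition Ext1 :: "('o, 'm) precategory \<Rightarrow> 'o \<Rightarrow> 'o \<Rightarrow> ('m \<times> 'm) set set" where
  "Ext1 A M X = extensions A M X // ext_equiv A M X"

definition Ext1_zero :: "('o, 'm) precategory \<Rightarrow> 'o \<Rightarrow> 'o \<Rightarrow> ('m \<times> 'm) set" where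
  "Ext1_zero A M X =
     {\<xi>. \<exists>S i j p q. biproduct A X M S i j p q \<and> ((i, q), \<xi>) \<in> ext_equiv A M X}"

definition left_perp :: "('o, 'm) precategory \<Rightarrow> 'o set \<Rightarrow> 'o set" where
  "left_perp A V = {M \<in> Obj A. \<forall>X\<in>V. Ext1 A M X = {Ext1_zero A M X}}"

definition special_preenvelope :: "('o, 'm) precategory \<Rightarrow> 'o set \<Rightarrow> 'o \<Rightarrow> 'm \<Rightarrow> 'm \<Rightarrow> bool" where
  "special_preenvelope A V M i p \<longleftrightarrow>
     short_exact A i p \<and> Dom A i = M \<and> Cod A i \<in> V \<and> Cod A p \<in> left_perp A V"

definition special_preenveloping :: "('o, 'm) precategory \<Rightarrow> 'o set \<Rightarrow> bool" where
  "special_preenveloping A V \<longleftrightarrow> (\<forall>M\<in>Obj A. \<exists>i p. special_preenvelope A V M i p)"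


section \<open>Contravariant additive functors to abelian groups\<close>

text \<open>
  Abelian groups are the \<^const>\<open>comm_group\<close>s of \<^theory>\<open>HOL-Algebra.Group\<close>, hence written
  multiplicatively. All requirements on the maps \<open>Farr F f\<close> are relative to the carriers.
\<close>

record ('o, 'm, 'g) cofunctor =
  Fobj :: "'o \<Rightarrow> 'g monoid"
  Farr :: "'m \<Rightarrow> 'g \<Rightarrow> 'g"

definition additive_cofunctor ::
    "('o, 'm) precategory \<Rightarrow> ('o, 'm, 'g) cofunctor \<Rightarrow> bool" where
  "additive_cofunctor A F \<longleftrightarrow>
     (\<forall>X\<in>Obj A. comm_group (Fobj F X)) \<and>
     (\<forall>X Y. \<forall>f\<in>Hom A X Y. Farr F f \<in> hom (Fobj F Y) (Fobj F X)) \<and>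
     (\<forall>X\<in>Obj A. \<forall>x\<in>carrier (Fobj F X). Farr F (Ident A X) x = x) \<and>
     (\<forall>X Y Z. \<forall>f\<in>Hom A X Y. \<forall>g\<in>Hom A Y Z. \<forall>x\<in>carrier (Fobj F Z).
        Farr F (g \<cdot>\<^bsub>A\<^esub> f) x = Farr F f (Farr F g x)) \<and>
     (\<forall>X Y. \<forall>f\<in>Hom A X Y. \<forall>g\<in>Hom A X Y. \<forall>x\<in>carrier (Fobj F Y).
        Farr F (Plus A f g) x = Farr F f x \<otimes>\<^bsub>Fobj F X\<^esub> Farr F g x)"

definition zero_cofunctor :: "('o, 'm) precategory \<Rightarrow> ('o, 'm, 'g) cofunctor \<Rightarrow> bool" where
  "zero_cofunctor A F \<longleftrightarrow> (\<forall>X\<in>Obj A. trivial_group (Fobj F X))"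

definition Hom_cofunctor :: "('o, 'm) precategory \<Rightarrow> 'o \<Rightarrow> ('o, 'm, 'm) cofunctor" where
  "Hom_cofunctor A W = \<lparr>Fobj = (\<lambda>X. Hom_group A X W), Farr = (\<lambda>f g. g \<cdot>\<^bsub>A\<^esub> f)\<rparr>"

text \<open>
  For arrows \<open>i : X' \<rightarrow> X\<close> and \<open>p : X \<rightarrow> X''\<close>: exactness of \<open>F X'' \<rightarrow> F X \<rightarrow> F X'\<close>, and of that
  sequence extended by 0 on the left, respectively on the right. The lists of
  \<^const>\<open>exact_seq\<close> are read from right to left.
\<close>

definition F_exact :: "('o, 'm) precategory \<Rightarrow> ('o, 'm, 'g) cofunctor \<Rightarrow> 'm \<Rightarrow> 'm \<Rightarrow> bool" where
  "F_exact A F i p \<longleftrightarrow>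
     exact_seq ([Fobj F (Dom A i), Fobj F (Cod A i), Fobj F (Cod A p)], [Farr F i, Farr F p])"

definition F_left_exact :: "('o, 'm) precategory \<Rightarrow> ('o, 'm, 'g) cofunctor \<Rightarrow> 'm \<Rightarrow> 'm \<Rightarrow> bool" where
  "F_left_exact A F i p \<longleftrightarrow> F_exact A F i p \<and> inj_on (Farr F p) (carrier (Fobj F (Cod A p)))"

definition F_right_exact :: "('o, 'm) precategory \<Rightarrow> ('o, 'm, 'g) cofunctor \<Rightarrow> 'm \<Rightarrow> 'm \<Rightarrow> bool" where
  "F_right_exact A F i p \<longleftrightarrow> F_exact A F i p \<and>
     Farr F i ` carrier (Fobj F (Cod A i)) = carrier (Fobj F (Dom A i))"

definition Hom_exact_short_exact :: "('o, 'm) precategory \<Rightarrow> 'o set \<Rightarrow> 'm \<Rightarrow> 'm \<Rightarrow> bool" where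
  "Hom_exact_short_exact A V i p \<longleftrightarrow> short_exact A i p \<and>
     (\<forall>W\<in>V. F_left_exact A (Hom_cofunctor A W) i p \<and> F_right_exact A (Hom_cofunctor A W) i p)"

definition half_Hom_exact :: "('o, 'm) precategory \<Rightarrow> 'o set \<Rightarrow> ('o, 'm, 'g) cofunctor \<Rightarrow> bool" where
  "half_Hom_exact A V F \<longleftrightarrow> (\<forall>i p. Hom_exact_short_exact A V i p \<longrightarrow> F_exact A F i p)"

definition left_Hom_exact :: "('o, 'm) precategory \<Rightarrow> 'o set \<Rightarrow> ('o, 'm, 'g) cofunctor \<Rightarrow> bool" where
  "left_Hom_exact A V F \<longleftrightarrow> (\<forall>i p. Hom_exact_short_exact A V i p \<longrightarrow> F_left_exact A F i p)"

definition right_Hom_exact :: "('o, 'm) precategory \<Rightarrow> 'o set \<Rightarrow> ('o, 'm, 'g) cofunctor \<Rightarrow> bool" where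
  "right_Hom_exact A V F \<longleftrightarrow> (\<forall>i p. Hom_exact_short_exact A V i p \<longrightarrow> F_right_exact A F i p)"


section \<open>Proper coresolutions and cosyzygies\<close>

text \<open>
  A coresolution is recorded as the exact sequence \<open>0 \<rightarrow> M \<rightarrow> I\<^sup>0 \<rightarrow> I\<^sup>1 \<rightarrow> \<cdots>\<close>: the complex is indexed
  by the natural numbers (its negative terms being 0) and the isomorphism \<open>M \<cong> H\<^sup>0(I)\<close> is
  recorded as the augmentation \<open>M \<rightarrow> I\<^sup>0\<close>.
\<close>

record ('o, 'm) coresolution =
  term_at :: "nat \<Rightarrow> 'o"
  diff_at :: "nat \<Rightarrow> 'm"
  augm :: "'m"

definition proper_coresolution ::
    "('o, 'm) precategory \<Rightarrow> 'o set \<Rightarrow> 'o \<Rightarrow> ('o, 'm) coresolution \<Rightarrow> bool" where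
  "proper_coresolution A V M I \<longleftrightarrow>
     (\<forall>n. term_at I n \<in> V) \<and>
     augm I \<in> Hom A M (term_at I 0) \<and>
     (\<forall>n. diff_at I n \<in> Hom A (term_at I n) (term_at I (Suc n))) \<and>
     mono_arr A (augm I) \<and>
     exact_at A (augm I) (diff_at I 0) \<and>
     (\<forall>n. exact_at A (diff_at I n) (diff_at I (Suc n))) \<and>
     (\<forall>W\<in>V. F_right_exact A (Hom_cofunctor A W) (augm I) (diff_at I 0) \<and>
        (\<forall>n. F_exact A (Hom_cofunctor A W) (diff_at I n) (diff_at I (Suc n))))"

definition special_proper_coresolution ::
    "('o, 'm) precategory \<Rightarrow> 'o set \<Rightarrow> 'o \<Rightarrow> ('o, 'm) coresolution \<Rightarrow> bool" where
  "special_proper_coresolution A V M I \<longleftrightarrow> proper_coresolution A V M I \<and>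
     (\<forall>n\<ge>1. \<forall>k. kernel_arr A k (diff_at I n) \<longrightarrow> Dom A k \<in> left_perp A V)"

text \<open>\<open>T\<close> is an \<open>n\<close>th \<open>V\<close>-cosyzygy of \<open>M\<close>; it is determined by \<open>M\<close> only up to summands in \<open>V\<close>.\<close>

definition cosyzygy :: "('o, 'm) precategory \<Rightarrow> 'o set \<Rightarrow> nat \<Rightarrow> 'o \<Rightarrow> 'o \<Rightarrow> bool" where
  "cosyzygy A V n M T \<longleftrightarrow>
     (\<exists>I k. special_proper_coresolution A V M I \<and> kernel_arr A k (diff_at I n) \<and> Dom A k = T)"


section \<open>The stable functor\<close>

definition L0_obj :: "('o, 'm, 'g) cofunctor \<Rightarrow> ('o, 'm) coresolution \<Rightarrow> 'g set monoid" where
  "L0_obj F I = Fobj F (term_at I 0) Mod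
     (Farr F (diff_at I 0) ` carrier (Fobj F (term_at I 1)))"

text \<open>\<open>F(augm I)\<close> is constant on each coset in \<open>L0_obj F I\<close>; \<open>rho\<close> is the induced map.\<close>

definition rho :: "('o, 'm, 'g) cofunctor \<Rightarrow> ('o, 'm) coresolution \<Rightarrow> 'g set \<Rightarrow> 'g" where
  "rho F I S = the_elem (Farr F (augm I) ` S)"

definition rho_image :: "('o, 'm, 'g) cofunctor \<Rightarrow> ('o, 'm) coresolution \<Rightarrow> 'g set" where
  "rho_image F I = rho F I ` carrier (L0_obj F I)"

text \<open>
  The cokernel of \<open>rho\<close>, for a family \<open>I\<close> of proper coresolutions, one for each object. Cokernels of
  natural transformations are pointwise: an arrow \<open>f : M \<rightarrow> N\<close> acts by sending the coset of \<open>x\<close> in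
  \<open>F(N)\<close> to the coset of \<open>F(f)(x)\<close> in \<open>F(M)\<close>.
\<close>

definition stable_functor :: "('o, 'm) precategory \<Rightarrow> ('o \<Rightarrow> ('o, 'm) coresolution) \<Rightarrow>
    ('o, 'm, 'g) cofunctor \<Rightarrow> ('o, 'm, 'g set) cofunctor" where
  "stable_functor A I F = \<lparr>
     Fobj = (\<lambda>M. Fobj F M Mod rho_image F (I M)),
     Farr = (\<lambda>f S. \<Union>x\<in>S. rho_image F (I (Dom A f)) #>\<^bsub>Fobj F (Dom A f)\<^esub> Farr F f x)\<rparr>"


subsection \<open>The stable functor is a contravariant additive functor\<close>

lemma HomD: "f \<in> Hom A X Y \<Longrightarrow> f \<in> Arr A \<and> Dom A f = X \<and> Cod A f = Y"
  by (simp add: Hom_def)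

context preadditive_category begin

lemma Hom_objs: "f \<in> Hom A X Y \<Longrightarrow> X \<in> Obj A \<and> Y \<in> Obj A"
  using Dom_closed Cod_closed by (auto simp: Hom_def)

lemma Zero_closed: "X \<in> Obj A \<Longrightarrow> Y \<in> Obj A \<Longrightarrow> Zero A X Y \<in> Hom A X Y"
  using Hom_comm_group[of X Y] monoid.one_closed[of "Hom_group A X Y"]
  by (auto simp: Hom_group_def comm_group_def group_def)

lemma Zero_Plus: "f \<in> Hom A X Y \<Longrightarrow> Plus A (Zero A X Y) f = f"
  using Hom_comm_group[of X Y] monoid.l_one[of "Hom_group A X Y" f] Hom_objs
  by (auto simp: Hom_group_def comm_group_def group_def)

lemma idem_Zero: assumes "f \<in> Hom A X Y" "Plus A f f = f" shows "f = Zero A X Y"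
proof -
  interpret G: comm_group "Hom_group A X Y" using Hom_comm_group assms Hom_objs by blast
  show ?thesis using G.l_cancel_one'[of f f] assms by (simp add: Hom_group_def)
qed

lemma Zero_Comp: assumes "f \<in> Hom A X Y" "Z \<in> Obj A" shows "Zero A Y Z \<cdot> f = Zero A X Z"
proof -
  have z: "Zero A Y Z \<in> Hom A Y Z" using Zero_closed assms Hom_objs by blast
  show ?thesis
    using idem_Zero[OF Comp_closed[OF assms(1) z]] Plus_Comp[OF assms(1) z z] Zero_Plus[OF z]
    by metis
qed

lemma exact_at_Comp:
  assumes "exact_at A f g" "f \<in> Hom A X Y" "g \<in> Hom A Y Z"
  shows "g \<cdot> f = Zero A X Z"
proof -
  obtain m c where c: "cokernel_arr A c f" and m: "kernel_arr A m c" and g: "kernel_arr A m g"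
    using assms(1) unfolding exact_at_def image_arr_def by blast
  have fc: "f \<in> Hom A X (Dom A c)" "c \<cdot> f = Zero A X (Cod A c)"
    using c assms by (auto simp: cokernel_arr_def Hom_def)
  then obtain u where u: "u \<in> Hom A X (Dom A m)" "m \<cdot> u = f"
    using m fc unfolding kernel_arr_def by metis
  have mm: "m \<in> Hom A (Dom A m) Y" "g \<cdot> m = Zero A (Dom A m) Z"
    using g assms by (auto simp: kernel_arr_def Hom_def)
  show ?thesis using Comp_assoc[OF u(1) mm(1) assms(3)] u(2) mm(2) Zero_Comp[OF u(1)] assms Hom_objs by metis
qed

lemma F_Zero:
  assumes F: "additive_cofunctor A F" and "X \<in> Obj A" "Y \<in> Obj A" "x \<in> carrier (Fobj F Y)"
  shows "Farr F (Zero A X Y) x = \<one>\<^bsub>Fobj F X\<^esub>"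
proof -
  have z: "Zero A X Y \<in> Hom A X Y" using Zero_closed assms by blast
  interpret G: comm_group "Fobj F X" using F assms by (auto simp: additive_cofunctor_def)
  have c: "Farr F (Zero A X Y) x \<in> carrier (Fobj F X)"
    using F z assms by (fastforce simp: additive_cofunctor_def hom_def)
  have "Farr F (Plus A (Zero A X Y) (Zero A X Y)) x = Farr F (Zero A X Y) x \<otimes>\<^bsub>Fobj F X\<^esub> Farr F (Zero A X Y) x"
    using F z assms unfolding additive_cofunctor_def by blast
  then show ?thesis using Zero_Plus[OF z] c G.l_cancel_one' by metis
qed

lemma rho_image_eq:
  assumes F: "additive_cofunctor A F" and P: "proper_coresolution A V M I"
  shows "rho_image F I = Farr F (augm I) ` carrier (Fobj F (term_at I 0))"
proof -
  let ?G = "Fobj F (term_at I 0)" and ?H = "Fobj F M" and ?K = "Fobj F (term_at I 1)"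
  let ?N = "Farr F (diff_at I 0) ` carrier ?K"
  have aug: "augm I \<in> Hom A M (term_at I 0)" and d: "diff_at I 0 \<in> Hom A (term_at I 0) (term_at I 1)"
    using P by (auto simp: proper_coresolution_def)
  have obj: "M \<in> Obj A" "term_at I 0 \<in> Obj A" "term_at I 1 \<in> Obj A" using aug d Hom_objs by auto
  interpret G: comm_group ?G using F obj by (auto simp: additive_cofunctor_def)
  interpret H: comm_group ?H using F obj by (auto simp: additive_cofunctor_def)
  interpret K: comm_group ?K using F obj by (auto simp: additive_cofunctor_def)
  interpret a: group_hom ?G ?H "Farr F (augm I)" 
    by unfold_locales (use F aug in \<open>auto simp: additive_cofunctor_def\<close>)
  interpret dd: group_hom ?K ?G "Farr F (diff_at I 0)" 
    by unfold_locales (use F d in \<open>auto simp: additive_cofunctor_def\<close>)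
  have N: "subgroup ?N ?G" using dd.img_is_subgroup .
  have z: "diff_at I 0 \<cdot> augm I = Zero A M (term_at I 1)"
    using exact_at_Comp aug d P unfolding proper_coresolution_def by blast
  have ad: "Farr F (augm I) (Farr F (diff_at I 0) y) = \<one>\<^bsub>?H\<^esub>" if "y \<in> carrier ?K" for y
  proof -
    have "Farr F (diff_at I 0 \<cdot> augm I) y = Farr F (augm I) (Farr F (diff_at I 0) y)"
      using F aug d that unfolding additive_cofunctor_def by blast
    then show ?thesis using F_Zero[OF F obj(1,3) that] z by simp
  qed
  have im: "Farr F (augm I) ` (?N #>\<^bsub>?G\<^esub> x) = {Farr F (augm I) x}" if x: "x \<in> carrier ?G" for x
  proof -
    have e: "Farr F (augm I) z = Farr F (augm I) x" if z: "z \<in> ?N #>\<^bsub>?G\<^esub> x" for z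
    proof -
      obtain y where y: "y \<in> carrier ?K" "z = Farr F (diff_at I 0) y \<otimes>\<^bsub>?G\<^esub> x"
        using z unfolding r_coset_def by blast
      show ?thesis unfolding y(2) a.hom_mult[OF dd.hom_closed[OF y(1)] x] ad[OF y(1)]
        using H.l_one[OF a.hom_closed[OF x]] .
    qed
    have "x \<in> ?N #>\<^bsub>?G\<^esub> x" using G.rcos_self[OF x N] .
    with e show ?thesis by blast
  qed
  have "carrier (L0_obj F I) = (\<lambda>x. ?N #>\<^bsub>?G\<^esub> x) ` carrier ?G"
    by (auto simp: L0_obj_def FactGroup_def RCOSETS_def)
  then have "rho_image F I =
      (\<lambda>x. the_elem (Farr F (augm I) ` (?N #>\<^bsub>?G\<^esub> x))) ` carrier ?G"
    unfolding rho_image_def rho_def by (simp only: image_image)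
  also have "\<dots> = Farr F (augm I) ` carrier ?G"
    by (rule image_cong[OF refl]) (simp only: im the_elem_eq)
  finally show ?thesis .
qed

lemma rho_image_natural:
  assumes F: "additive_cofunctor A F" 
    and P: "proper_coresolution A V M I" and P': "proper_coresolution A V N J"
    and f: "f \<in> Hom A M N" and y: "y \<in> rho_image F J"
  shows "Farr F f y \<in> rho_image F I"
proof -
  have aug: "augm I \<in> Hom A M (term_at I 0)" and aug': "augm J \<in> Hom A N (term_at J 0)"
    and W: "term_at J 0 \<in> V"
    using P P' by (auto simp: proper_coresolution_def)
  have "F_right_exact A (Hom_cofunctor A (term_at J 0)) (augm I) (diff_at I 0)"
    using P W by (auto simp: proper_coresolution_def)
  moreover have "augm J \<cdot> f \<in> Hom A M (term_at J 0)" using Comp_closed f aug' by blast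
  ultimately have "augm J \<cdot> f \<in> (\<lambda>g. g \<cdot> augm I) ` Hom A (term_at I 0) (term_at J 0)"
    using aug by (auto simp: F_right_exact_def Hom_cofunctor_def Hom_group_def Hom_def)
  then obtain h where h: "h \<in> Hom A (term_at I 0) (term_at J 0)" "augm J \<cdot> f = h \<cdot> augm I" by blast
  obtain x where x: "x \<in> carrier (Fobj F (term_at J 0))" "y = Farr F (augm J) x"
    using y rho_image_eq[OF F P'] by blast
  have "Farr F (augm J \<cdot> f) x = Farr F f (Farr F (augm J) x)"
    "Farr F (h \<cdot> augm I) x = Farr F (augm I) (Farr F h x)"
    using F aug aug' f h x unfolding additive_cofunctor_def by blast+
  moreover have "Farr F h x \<in> carrier (Fobj F (term_at I 0))" 
    using F h x by (fastforce simp: additive_cofunctor_def hom_def)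
  ultimately show ?thesis using rho_image_eq[OF F P] x h by (metis imageI)
qed

end

lemma (in preadditive_category) stable_functor_additive:
  fixes F :: "('o, 'm, 'g) cofunctor"
  assumes F: "additive_cofunctor A F"
    and P: "\<And>M. M \<in> Obj A \<Longrightarrow> proper_coresolution A V M (I M)"
  shows "additive_cofunctor A (stable_functor A I F)"
proof -
  let ?R = "\<lambda>M. rho_image F (I M)"
  let ?S = "stable_functor A I F"
  have cg: "comm_group (Fobj F M)" if "M \<in> Obj A" for M using F that by (auto simp: additive_cofunctor_def)
  have R: "subgroup (?R M) (Fobj F M)" if M: "M \<in> Obj A" for M
  proof -
    have aug: "augm (I M) \<in> Hom A M (term_at (I M) 0)" using P[OF M] by (auto simp: proper_coresolution_def)
    interpret G: comm_group "Fobj F (term_at (I M) 0)" using cg aug Hom_objs by blast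
    interpret H: comm_group "Fobj F M" using cg M by blast
    interpret a: group_hom "Fobj F (term_at (I M) 0)" "Fobj F M" "Farr F (augm (I M))" 
      by unfold_locales (use F aug in \<open>auto simp: additive_cofunctor_def\<close>)
    show ?thesis using a.img_is_subgroup rho_image_eq[OF F P[OF M]] by simp
  qed
  have Sc: "carrier (Fobj ?S M) = (\<lambda>x. ?R M #>\<^bsub>Fobj F M\<^esub> x) ` carrier (Fobj F M)" for M
    by (auto simp: stable_functor_def FactGroup_def RCOSETS_def)
  have Sm: "(?R M #>\<^bsub>Fobj F M\<^esub> x) \<otimes>\<^bsub>Fobj ?S M\<^esub> (?R M #>\<^bsub>Fobj F M\<^esub> y) = ?R M #>\<^bsub>Fobj F M\<^esub> (x \<otimes>\<^bsub>Fobj F M\<^esub> y)"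
    if M: "M \<in> Obj A" "x \<in> carrier (Fobj F M)" "y \<in> carrier (Fobj F M)" for M x y
  proof -
    interpret H: comm_group "Fobj F M" using cg M by blast
    interpret N: normal "?R M" "Fobj F M" using H.normal_iff_subgroup R M by blast
    show ?thesis using N.rcos_sum[of x y] M by (simp add: stable_functor_def FactGroup_def)
  qed
  have Fc: "Farr F f x \<in> carrier (Fobj F M)" if "f \<in> Hom A M N" "x \<in> carrier (Fobj F N)" for f M N x
    using F that by (fastforce simp: additive_cofunctor_def hom_def)
  have Fm: "Farr F f (x \<otimes>\<^bsub>Fobj F N\<^esub> y) = Farr F f x \<otimes>\<^bsub>Fobj F M\<^esub> Farr F f y" 
    if "f \<in> Hom A M N" "x \<in> carrier (Fobj F N)" "y \<in> carrier (Fobj F N)" for f M N x y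
    using F that by (fastforce simp: additive_cofunctor_def hom_def)
  have Sa: "Farr ?S f (?R N #>\<^bsub>Fobj F N\<^esub> x) = ?R M #>\<^bsub>Fobj F M\<^esub> Farr F f x"
    if f: "f \<in> Hom A M N" and x: "x \<in> carrier (Fobj F N)" for f M N x
  proof -
    have MN: "M \<in> Obj A" "N \<in> Obj A" using f Hom_objs by auto
    interpret H: comm_group "Fobj F M" using cg MN by blast
    interpret K: comm_group "Fobj F N" using cg MN by blast
    have 1: "?R M #>\<^bsub>Fobj F M\<^esub> Farr F f z = ?R M #>\<^bsub>Fobj F M\<^esub> Farr F f x" 
      if z: "z \<in> ?R N #>\<^bsub>Fobj F N\<^esub> x" for z
    proof -
      obtain r where r: "r \<in> ?R N" "z = r \<otimes>\<^bsub>Fobj F N\<^esub> x" using z by (auto simp: r_coset_def)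
      have rc: "r \<in> carrier (Fobj F N)" using subgroup.mem_carrier[OF R] r MN by blast
      have "Farr F f r \<in> ?R M" using rho_image_natural[OF F P P f] r MN by blast
      then have "Farr F f z \<in> ?R M #>\<^bsub>Fobj F M\<^esub> Farr F f x" 
        using r Fm[OF f rc x] by (auto simp: r_coset_def)
      then show ?thesis using H.repr_independence[OF _ Fc[OF f x] R[OF MN(1)]] by simp
    qed
    have "?R N #>\<^bsub>Fobj F N\<^esub> x \<noteq> {}" using K.rcos_self[OF x R[OF MN(2)]] by blast
    then have "(\<Union>z\<in>?R N #>\<^bsub>Fobj F N\<^esub> x. ?R M #>\<^bsub>Fobj F M\<^esub> Farr F f z) =
        ?R M #>\<^bsub>Fobj F M\<^esub> Farr F f x"
      by (intro SUP_eq_const 1)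
    then show ?thesis using HomD[OF f] by (simp only: stable_functor_def cofunctor.simps)
  qed
  show ?thesis unfolding additive_cofunctor_def
  proof (intro conjI ballI allI)
    fix M assume "M \<in> Obj A"
    interpret H: comm_group "Fobj F M" using cg \<open>M \<in> Obj A\<close> by blast
    show "comm_group (Fobj ?S M)" using H.abelian_FactGroup[OF R[OF \<open>M \<in> Obj A\<close>]] by (simp add: stable_functor_def)
  next
    fix M N f assume f: "f \<in> Hom A M N"
    have MN: "M \<in> Obj A" "N \<in> Obj A" using f Hom_objs by auto
    interpret K: comm_group "Fobj F N" using cg MN by blast
    show "Farr ?S f \<in> hom (Fobj ?S N) (Fobj ?S M)"
    proof (rule homI)
      fix S assume "S \<in> carrier (Fobj ?S N)"
      then obtain x where x: "x \<in> carrier (Fobj F N)" "S = ?R N #>\<^bsub>Fobj F N\<^esub> x" using Sc[of N] by blast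
      then show "Farr ?S f S \<in> carrier (Fobj ?S M)" using Sa[OF f x(1)] Sc[of M] Fc[OF f x(1)] by auto
      fix T assume "T \<in> carrier (Fobj ?S N)"
      then obtain y where y: "y \<in> carrier (Fobj F N)" "T = ?R N #>\<^bsub>Fobj F N\<^esub> y" using Sc[of N] by blast
      show "Farr ?S f (S \<otimes>\<^bsub>Fobj ?S N\<^esub> T) = Farr ?S f S \<otimes>\<^bsub>Fobj ?S M\<^esub> Farr ?S f T"
        using x y MN f by (simp add: Sm Sa Fm Fc)
    qed
  next
    fix M S assume M: "M \<in> Obj A" "S \<in> carrier (Fobj ?S M)"
    then obtain x where x: "x \<in> carrier (Fobj F M)" "S = ?R M #>\<^bsub>Fobj F M\<^esub> x" using Sc[of M] by blast
    have "Farr F (Ident A M) x = x" using F M x by (auto simp: additive_cofunctor_def)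
    then show "Farr ?S (Ident A M) S = S" using Sa[OF Ident_closed[OF M(1)] x(1)] x by simp
  next
    fix X Y Z f g S assume a: "f \<in> Hom A X Y" "g \<in> Hom A Y Z" "S \<in> carrier (Fobj ?S Z)"
    then obtain x where x: "x \<in> carrier (Fobj F Z)" "S = ?R Z #>\<^bsub>Fobj F Z\<^esub> x" using Sc[of Z] by blast
    have "Farr F (g \<cdot> f) x = Farr F f (Farr F g x)" using F a x unfolding additive_cofunctor_def by blast
    then show "Farr ?S (g \<cdot> f) S = Farr ?S f (Farr ?S g S)" 
      using Sa[OF a(2) x(1)] Sa[OF a(1) Fc[OF a(2) x(1)]] Sa[OF Comp_closed[OF a(1,2)] x(1)] x by simp
  next
    fix X Y f g S assume a: "f \<in> Hom A X Y" "g \<in> Hom A X Y" "S \<in> carrier (Fobj ?S Y)"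
    then obtain x where x: "x \<in> carrier (Fobj F Y)" "S = ?R Y #>\<^bsub>Fobj F Y\<^esub> x" using Sc[of Y] by blast
    have X: "X \<in> Obj A" "Y \<in> Obj A" using Hom_objs a by auto
    have e: "Farr F (Plus A f g) x = Farr F f x \<otimes>\<^bsub>Fobj F X\<^esub> Farr F g x" using F a x unfolding additive_cofunctor_def by blast
    interpret HG: comm_group "Hom_group A X Y" using Hom_comm_group X by blast
    have "Plus A f g \<in> Hom A X Y" using HG.m_closed[of f g] a by (simp add: Hom_group_def)
    then show "Farr ?S (Plus A f g) S = Farr ?S f S \<otimes>\<^bsub>Fobj ?S X\<^esub> Farr ?S g S"
      using Sa[OF a(1) x(1)] Sa[OF a(2) x(1)] Sa[OF _ x(1)] x e Sm[OF X(1) Fc[OF a(1) x(1)] Fc[OF a(2) x(1)]] by simp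
  qed
qed

end

theory Submission
  imports Defs
begin

text \<open>
  The value of the stable functor at \<open>M\<close> is \<open>F(M)\<close> modulo the subgroup \<open>R(M)\<close> of the elements
  \<open>F(f)(y)\<close> with \<open>f : M \<rightarrow> W\<close>, \<open>W \<in> V\<close> and \<open>y \<in> F(W)\<close>. In a \<open>Hom(-,V)\<close>-exact sequence
  \<open>0 \<rightarrow> X \<rightarrow> Y \<rightarrow> Z \<rightarrow> 0\<close> every such \<open>f\<close> out of \<open>X\<close> extends to \<open>Y\<close>, which yields half exactness, and
  surjectivity of \<open>F(Y) \<rightarrow> F(X)\<close> once \<open>R(X) = F(X)\<close>. The remaining implications apply exactness to
  \<open>0 \<rightarrow> \<Theta>\<^sup>n\<^sup>-\<^sup>1M \<rightarrow> I\<^sup>n\<^sup>-\<^sup>1 \<rightarrow> \<Theta>\<^sup>nM \<rightarrow> 0\<close>, whose middle term is killed by the stable functor, or compare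
  \<open>0 \<rightarrow> X \<rightarrow> Y \<rightarrow> Z \<rightarrow> 0\<close> with \<open>0 \<rightarrow> X \<rightarrow> I\<^sup>0 \<rightarrow> \<Theta>X \<rightarrow> 0\<close>.
\<close>

section \<open>Kernels and cokernels\<close>

context preadditive_category begin

lemma Comp_Zero:
  assumes "f \<in> Hom A Y Z" "X \<in> Obj A"
  shows "f \<cdot> Zero A X Y = Zero A X Z"
proof -
  have z: "Zero A X Y \<in> Hom A X Y" using Zero_closed assms Hom_objs by blast
  show ?thesis
    using idem_Zero[OF Comp_closed[OF z assms(1)]] Comp_Plus[OF z z assms(1)] Zero_Plus[OF z]
    by metis
qed

lemma Plus_eq_right_iff:
  assumes "f \<in> Hom A X Y" "g \<in> Hom A X Y"
  shows "Plus A f g = g \<longleftrightarrow> f = Zero A X Y"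
proof -
  interpret G: comm_group "Hom_group A X Y" using Hom_comm_group assms Hom_objs by blast
  show ?thesis using G.r_cancel_one[of g f] assms
    by (simp add: Hom_group_def)
qed

text \<open>The category record has \<open>Plus\<close> and \<open>Zero\<close> but no subtraction.
  Splitting off \<open>t\<close> replaces it: arrows are compared by showing that their difference
  \<open>t\<close> vanishes, or vanishes after composition.\<close>

lemma Hom_difference:
  assumes "f \<in> Hom A X Y" "g \<in> Hom A X Y"
  obtains t where "t \<in> Hom A X Y" "f = Plus A t g"
proof -
  interpret G: comm_group "Hom_group A X Y" using Hom_comm_group assms Hom_objs by blast
  define t where "t = f \<otimes>\<^bsub>Hom_group A X Y\<^esub> inv\<^bsub>Hom_group A X Y\<^esub> g"
  have "f \<in> carrier (Hom_group A X Y)" "g \<in> carrier (Hom_group A X Y)"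
    using assms by (auto simp: Hom_group_def)
  then have "t \<in> carrier (Hom_group A X Y)" "t \<otimes>\<^bsub>Hom_group A X Y\<^esub> g = f"
    by (simp_all add: t_def G.m_assoc)
  then show thesis using that by (simp add: Hom_group_def)
qed

lemma epi_arrI:
  assumes f: "f \<in> Hom A X Y"
    and "\<And>Z t. t \<in> Hom A Y Z \<Longrightarrow> t \<cdot> f = Zero A X Z \<Longrightarrow> t = Zero A Y Z"
  shows "epi_arr A f"
  unfolding epi_arr_def
proof (intro conjI allI ballI impI)
  show "f \<in> Arr A" using f by (simp add: Hom_def)
  fix Z g h assume "g \<in> Hom A (Cod A f) Z" "h \<in> Hom A (Cod A f) Z" and e: "g \<cdot> f = h \<cdot> f"
  then have g: "g \<in> Hom A Y Z" and h: "h \<in> Hom A Y Z" using f by (auto simp: Hom_def)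
  obtain t where t: "t \<in> Hom A Y Z" "g = Plus A t h" using Hom_difference[OF g h] .
  have "Plus A (t \<cdot> f) (h \<cdot> f) = h \<cdot> f" using Plus_Comp[OF f t(1) h] t(2) e by simp
  then have "t = Zero A Y Z"
    using assms(2)[OF t(1)] Plus_eq_right_iff Comp_closed f t(1) h by blast
  then show "g = h" using t(2) Zero_Plus[OF h] by simp
qed

lemma epi_cancel:
  assumes "epi_arr A f" "f \<in> Hom A X Y" "g \<in> Hom A Y Z" "h \<in> Hom A Y Z" "g \<cdot> f = h \<cdot> f"
  shows "g = h"
  using assms unfolding epi_arr_def Hom_def by blast

lemma mono_cancel:
  assumes "mono_arr A f" "f \<in> Hom A Y Z" "g \<in> Hom A X Y" "h \<in> Hom A X Y" "f \<cdot> g = f \<cdot> h"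
  shows "g = h"
  using assms unfolding mono_arr_def Hom_def by blast

lemma kernel_arrI:
  assumes "f \<in> Hom A X Y" "k \<in> Hom A K X" "mono_arr A k" "f \<cdot> k = Zero A K Y"
    and "\<And>Z h. h \<in> Hom A Z X \<Longrightarrow> f \<cdot> h = Zero A Z Y \<Longrightarrow> \<exists>u\<in>Hom A Z K. k \<cdot> u = h"
  shows "kernel_arr A k f"
  unfolding kernel_arr_def
proof (intro conjI allI ballI impI)
  fix Z h assume "h \<in> Hom A Z (Dom A f)" "f \<cdot> h = Zero A Z (Cod A f)"
  then obtain u where "u \<in> Hom A Z K" "k \<cdot> u = h" using assms(1,5) by (auto simp: Hom_def)
  then show "\<exists>!u. u \<in> Hom A Z (Dom A k) \<and> k \<cdot> u = h"
    using mono_cancel[OF assms(3,2)] HomD[OF assms(2)] by auto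
qed (use assms in \<open>auto simp: Hom_def\<close>)

lemma cokernel_arrI:
  assumes "f \<in> Hom A X Y" "c \<in> Hom A Y C" "epi_arr A c" "c \<cdot> f = Zero A X C"
    and "\<And>Z h. h \<in> Hom A Y Z \<Longrightarrow> h \<cdot> f = Zero A X Z \<Longrightarrow> \<exists>u\<in>Hom A C Z. u \<cdot> c = h"
  shows "cokernel_arr A c f"
  unfolding cokernel_arr_def
proof (intro conjI allI ballI impI)
  fix Z h assume "h \<in> Hom A (Cod A f) Z" "h \<cdot> f = Zero A (Dom A f) Z"
  then obtain u where "u \<in> Hom A C Z" "u \<cdot> c = h" using assms(1,5) by (auto simp: Hom_def)
  then show "\<exists>!u. u \<in> Hom A (Cod A c) Z \<and> u \<cdot> c = h"
    using epi_cancel[OF assms(3,2)] HomD[OF assms(2)] by auto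
qed (use assms in \<open>auto simp: Hom_def\<close>)

lemma kernel_arrD:
  assumes "kernel_arr A k f" "f \<in> Hom A X Y"
  shows "k \<in> Hom A (Dom A k) X" "f \<cdot> k = Zero A (Dom A k) Y" "mono_arr A k"
proof -
  show k: "k \<in> Hom A (Dom A k) X" and z: "f \<cdot> k = Zero A (Dom A k) Y"
    using assms by (auto simp: kernel_arr_def Hom_def)
  show "mono_arr A k" unfolding mono_arr_def
  proof (intro conjI allI ballI impI)
    show "k \<in> Arr A" using k by (simp add: Hom_def)
    fix Z g h
    assume g: "g \<in> Hom A Z (Dom A k)" and h: "h \<in> Hom A Z (Dom A k)" and e: "k \<cdot> g = k \<cdot> h"
    have "f \<cdot> (k \<cdot> h) = Zero A Z Y"
      using Comp_assoc[OF h k assms(2)] z Zero_Comp[OF h] Hom_objs assms(2) by metis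
    moreover have "k \<cdot> h \<in> Hom A Z X" using Comp_closed h k by blast
    ultimately have "\<exists>!u. u \<in> Hom A Z (Dom A k) \<and> k \<cdot> u = k \<cdot> h"
      using assms(1) HomD[OF assms(2)] unfolding kernel_arr_def by simp
    then show "g = h" using g h e by blast
  qed
qed

lemma kernel_lift:
  assumes "kernel_arr A k f" "f \<in> Hom A X Y" "h \<in> Hom A Z X" "f \<cdot> h = Zero A Z Y"
  obtains u where "u \<in> Hom A Z (Dom A k)" "k \<cdot> u = h"
proof -
  have "\<exists>!u. u \<in> Hom A Z (Dom A k) \<and> k \<cdot> u = h"
    using assms HomD[OF assms(2)] unfolding kernel_arr_def by simp
  then show thesis using that by blast
qed

lemma cokernel_arrD:
  assumes "cokernel_arr A c f" "f \<in> Hom A X Y"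
  shows "c \<in> Hom A Y (Cod A c)" "c \<cdot> f = Zero A X (Cod A c)" "epi_arr A c"
proof -
  show c: "c \<in> Hom A Y (Cod A c)" and z: "c \<cdot> f = Zero A X (Cod A c)"
    using assms by (auto simp: cokernel_arr_def Hom_def)
  show "epi_arr A c" unfolding epi_arr_def
  proof (intro conjI allI ballI impI)
    show "c \<in> Arr A" using c by (simp add: Hom_def)
    fix Z g h
    assume g: "g \<in> Hom A (Cod A c) Z" and h: "h \<in> Hom A (Cod A c) Z" and e: "g \<cdot> c = h \<cdot> c"
    have "(h \<cdot> c) \<cdot> f = Zero A X Z"
      using Comp_assoc[OF assms(2) c h] z Comp_Zero[OF h] Hom_objs assms(2) by metis
    moreover have "h \<cdot> c \<in> Hom A Y Z" using Comp_closed h c by blast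
    ultimately have "\<exists>!u. u \<in> Hom A (Cod A c) Z \<and> u \<cdot> c = h \<cdot> c"
      using assms(1) HomD[OF assms(2)] unfolding cokernel_arr_def by simp
    then show "g = h" using g h e by blast
  qed
qed

lemma cokernel_desc:
  assumes "cokernel_arr A c f" "f \<in> Hom A X Y" "h \<in> Hom A Y Z" "h \<cdot> f = Zero A X Z"
  obtains u where "u \<in> Hom A (Cod A c) Z" "u \<cdot> c = h"
proof -
  have "\<exists>!u. u \<in> Hom A (Cod A c) Z \<and> u \<cdot> c = h"
    using assms HomD[OF assms(2)] unfolding cokernel_arr_def by simp
  then show thesis using that by blast
qed

lemma mono_Zero:
  assumes "mono_arr A f" "f \<in> Hom A Y Z" "g \<in> Hom A X Y" "f \<cdot> g = Zero A X Z"
  shows "g = Zero A X Y"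
  using mono_cancel[OF assms(1-3) Zero_closed] Comp_Zero[OF assms(2)] assms Hom_objs by metis

lemma short_exact_Hom:
  assumes "short_exact A i p"
  obtains X Y Z where "i \<in> Hom A X Y" "p \<in> Hom A Y Z"
  using assms unfolding short_exact_def exact_at_def image_arr_def kernel_arr_def cokernel_arr_def
    Hom_def by force

end

section \<open>Abelian categories: normality of monos and epis, short exact sequences,
  corestrictions\<close>

context abelian_category begin

text \<open>By normality \<open>i\<close> is the kernel of some \<open>g\<close>. Since
  \<open>g\<close> kills \<open>i\<close>, it factors through \<open>c\<close>, so whatever
  \<open>c\<close> kills is killed by \<open>g\<close> and lifts through \<open>i\<close>.\<close>

lemma mono_kernel_cokernel:
  assumes "mono_arr A i" "i \<in> Hom A X Y" "cokernel_arr A c i"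
  shows "kernel_arr A i c"
proof -
  obtain g where g: "kernel_arr A i g" using mono_is_kernel[OF assms(1)] by blast
  then have gH: "g \<in> Hom A Y (Cod A g)" using assms(2) by (auto simp: kernel_arr_def Hom_def)
  have X: "Dom A i = X" using assms(2) by (simp add: Hom_def)
  note c = cokernel_arrD[OF assms(3,2)]
  obtain t where t: "t \<in> Hom A (Cod A c) (Cod A g)" "t \<cdot> c = g"
    using cokernel_desc[OF assms(3,2) gH] kernel_arrD(2)[OF g gH] X by blast
  show ?thesis
  proof (rule kernel_arrI[OF c(1) assms(2,1) c(2)])
    fix Z h assume h: "h \<in> Hom A Z Y" "c \<cdot> h = Zero A Z (Cod A c)"
    have "g \<cdot> h = Zero A Z (Cod A g)"
      using Comp_assoc[OF h(1) c(1) t(1)] t h Comp_Zero[OF t(1)] Hom_objs by metis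
    then show "\<exists>u\<in>Hom A Z X. i \<cdot> u = h" using kernel_lift[OF g gH h(1)] X by metis
  qed
qed

text \<open>Dual to \<open>mono_kernel_cokernel\<close>: \<open>p\<close> is the cokernel of some
  \<open>g\<close>, which factors through \<open>k\<close>.\<close>

lemma epi_cokernel_kernel:
  assumes "epi_arr A p" "p \<in> Hom A Y Z" "kernel_arr A k p"
  shows "cokernel_arr A p k"
proof -
  obtain g where g: "cokernel_arr A p g" using epi_is_cokernel[OF assms(1)] by blast
  then have gH: "g \<in> Hom A (Dom A g) Y" using assms(2) by (auto simp: cokernel_arr_def Hom_def)
  have Z: "Cod A p = Z" using assms(2) by (simp add: Hom_def)
  note k = kernel_arrD[OF assms(3,2)]
  obtain t where t: "t \<in> Hom A (Dom A g) (Dom A k)" "k \<cdot> t = g"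
    using kernel_lift[OF assms(3,2) gH] cokernel_arrD(2)[OF g gH] Z by blast
  show ?thesis
  proof (rule cokernel_arrI[OF k(1) assms(2,1) k(2)])
    fix W h assume h: "h \<in> Hom A Y W" "h \<cdot> k = Zero A (Dom A k) W"
    have "h \<cdot> g = Zero A (Dom A g) W"
      using Comp_assoc[OF t(1) k(1) h(1)] t h Zero_Comp[OF t(1)] Hom_objs by metis
    then show "\<exists>u\<in>Hom A Z W. u \<cdot> p = h" using cokernel_desc[OF g gH h(1)] Z by metis
  qed
qed

text \<open>Exactness provides one arrow \<open>m\<close> that is both an image of \<open>i\<close>
  and a kernel of \<open>p\<close>. A mono is a kernel of its own cokernel, so arrows killed by
  \<open>p\<close> pass through \<open>m\<close>, die under \<open>c\<close>, and lift through
  \<open>i\<close>.\<close>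

lemma exact_at_mono_kernel:
  assumes "exact_at A i p" "mono_arr A i" "i \<in> Hom A X Y" "p \<in> Hom A Y Z"
  shows "kernel_arr A i p"
proof -
  obtain m c where c: "cokernel_arr A c i" and m: "kernel_arr A m c" "kernel_arr A m p"
    using assms(1) unfolding exact_at_def image_arr_def by blast
  note cH = cokernel_arrD(1)[OF c assms(3)]
  note mH = kernel_arrD[OF m(1) cH]
  have ic: "kernel_arr A i c" using mono_kernel_cokernel[OF assms(2,3) c] .
  have X: "Dom A i = X" using assms(3) by (simp add: Hom_def)
  show ?thesis
  proof (rule kernel_arrI[OF assms(4,3,2) exact_at_Comp[OF assms(1,3,4)]])
    fix T h assume h: "h \<in> Hom A T Y" "p \<cdot> h = Zero A T Z"
    obtain u where u: "u \<in> Hom A T (Dom A m)" "m \<cdot> u = h"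
      using kernel_lift[OF m(2) assms(4) h] .
    have "c \<cdot> h = Zero A T (Cod A c)"
      using Comp_assoc[OF u(1) mH(1) cH] u(2) mH(2) Zero_Comp[OF u(1)] Hom_objs[OF cH] by simp
    then show "\<exists>u\<in>Hom A T X. i \<cdot> u = h" using kernel_lift[OF ic cH h(1)] X by metis
  qed
qed

lemma short_exact_kernel:
  assumes "short_exact A i p"
  shows "kernel_arr A i p" "cokernel_arr A p i"
proof -
  obtain X Y Z where H: "i \<in> Hom A X Y" "p \<in> Hom A Y Z" using short_exact_Hom[OF assms] .
  show k: "kernel_arr A i p"
    using exact_at_mono_kernel[OF _ _ H] assms by (simp add: short_exact_def)
  show "cokernel_arr A p i"
    using epi_cokernel_kernel[OF _ H(2) k] assms by (simp add: short_exact_def)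
qed

text \<open>The witness for \<open>exact_at\<close> is \<open>i\<close>: as a kernel of its cokernel
  \<open>p\<close>, it is its own image.\<close>

lemma short_exact_epi_kernel:
  assumes "epi_arr A p" "p \<in> Hom A Y Z" "kernel_arr A i p"
  shows "short_exact A i p"
  using epi_cokernel_kernel[OF assms] kernel_arrD(3)[OF assms(3,2)] assms
  unfolding short_exact_def exact_at_def image_arr_def by blast

lemma short_exact_mono_cokernel:
  assumes "mono_arr A i" "i \<in> Hom A X Y" "cokernel_arr A p i"
  shows "short_exact A i p"
  using mono_kernel_cokernel[OF assms] cokernel_arrD(3)[OF assms(3,2)] assms
  unfolding short_exact_def exact_at_def image_arr_def by blast

text \<open>If \<open>t\<close> kills the corestriction \<open>q\<close>, then \<open>d\<close> factors through \<open>k\<close> followed by the kernel of \<open>t\<close>,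
  a subobject as large as the image \<open>k\<close> of \<open>d\<close>; hence \<open>t\<close> is zero.\<close>

lemma exact_at_corestriction_epi:
  assumes ex: "exact_at A d d'" and d: "d \<in> Hom A X Y" and d': "d' \<in> Hom A Y Z"
    and k: "kernel_arr A k d'" and q: "q \<in> Hom A X (Dom A k)" "k \<cdot> q = d"
  shows "epi_arr A q"
proof (rule epi_arrI[OF q(1)])
  fix W t assume t: "t \<in> Hom A (Dom A k) W" "t \<cdot> q = Zero A X W"
  obtain m c where c: "cokernel_arr A c d" and m: "kernel_arr A m c" "kernel_arr A m d'"
    using ex unfolding exact_at_def image_arr_def by blast
  note cH = cokernel_arrD[OF c d] note kH = kernel_arrD[OF k d']
  note mH = kernel_arrD[OF m(1) cH(1)]
  \<comment> \<open>Both \<open>m\<close> and \<open>k\<close> are kernels of \<open>d'\<close>, so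
    \<open>k\<close> passes through the image \<open>m\<close> of \<open>d\<close>, which
    \<open>c\<close> kills.\<close>
  have ck: "c \<cdot> k = Zero A (Dom A k) (Cod A c)"
  proof -
    obtain v where v: "v \<in> Hom A (Dom A k) (Dom A m)" "m \<cdot> v = k"
      using kernel_lift[OF m(2) d' kH(1,2)] .
    show ?thesis using Comp_assoc[OF v(1) mH(1) cH(1)] mH(2) v Zero_Comp[OF v(1)] Hom_objs[OF cH(1)]
      by simp
  qed
  obtain l where l: "kernel_arr A l t" using kernel_exists HomD[OF t(1)] by blast
  note lH = kernel_arrD[OF l t(1)]
  obtain q' where q': "q' \<in> Hom A X (Dom A l)" "l \<cdot> q' = q"
    using kernel_lift[OF l t(1) q(1) t(2)] .
  have klH: "k \<cdot> l \<in> Hom A (Dom A l) Y" using Comp_closed[OF lH(1) kH(1)] .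
  have "mono_arr A (k \<cdot> l)" unfolding mono_arr_def
  proof (intro conjI allI ballI impI)
    show "k \<cdot> l \<in> Arr A" using HomD[OF klH] by blast
    fix U g h assume gh: "g \<in> Hom A U (Dom A (k \<cdot> l))" "h \<in> Hom A U (Dom A (k \<cdot> l))"
      "(k \<cdot> l) \<cdot> g = (k \<cdot> l) \<cdot> h"
    then have g: "g \<in> Hom A U (Dom A l)" and h: "h \<in> Hom A U (Dom A l)" using HomD[OF klH] by auto
    have "l \<cdot> g = l \<cdot> h"
      using mono_cancel[OF kH(3,1) Comp_closed[OF g lH(1)] Comp_closed[OF h lH(1)]] gh(3)
        Comp_assoc[OF g lH(1) kH(1)] Comp_assoc[OF h lH(1) kH(1)] by simp
    then show "g = h" using mono_cancel[OF lH(3,1) g h] by simp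
  qed
  \<comment> \<open>As a mono, \<open>k \<cdot> l\<close> is the kernel of some \<open>s\<close>.
    Since \<open>d\<close> factors through \<open>k \<cdot> l\<close>, \<open>s\<close> kills
    \<open>d\<close> and factors through \<open>c\<close>; as \<open>c\<close> kills
    \<open>k\<close>, so does \<open>s\<close>.\<close>
  then obtain s where s: "kernel_arr A (k \<cdot> l) s" using mono_is_kernel by blast
  then have sH: "s \<in> Hom A Y (Cod A s)" using klH by (auto simp: kernel_arr_def Hom_def)
  have "d = (k \<cdot> l) \<cdot> q'" using Comp_assoc[OF q'(1) lH(1) kH(1)] q' q by simp
  then have "s \<cdot> d = Zero A X (Cod A s)"
    using Comp_assoc[OF q'(1) klH sH] kernel_arrD(2)[OF s sH] HomD[OF klH]
      Zero_Comp[OF q'(1)] Hom_objs[OF sH] by simp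
  then obtain s' where s': "s' \<in> Hom A (Cod A c) (Cod A s)" "s' \<cdot> c = s"
    using cokernel_desc[OF c d sH] by blast
  have "s \<cdot> k = Zero A (Dom A k) (Cod A s)"
    using Comp_assoc[OF kH(1) cH(1) s'(1)] s' ck Comp_Zero[OF s'(1)] Hom_objs[OF kH(1)] by simp
  \<comment> \<open>Thus \<open>k\<close> lifts through its own subobject
    \<open>k \<cdot> l\<close>. Cancelling \<open>k\<close> makes \<open>r\<close> a section of
    \<open>l\<close>, and \<open>t\<close> equals \<open>t \<cdot> l \<cdot> r\<close>, which is
    zero.\<close>
  then obtain r where r: "r \<in> Hom A (Dom A k) (Dom A l)" "(k \<cdot> l) \<cdot> r = k"
    using kernel_lift[OF s sH kH(1)] HomD[OF klH] by metis
  have K: "Dom A k \<in> Obj A" using Hom_objs[OF kH(1)] by blast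
  have "l \<cdot> r = Ident A (Dom A k)"
    using mono_cancel[OF kH(3,1) Comp_closed[OF r(1) lH(1)] Ident_closed[OF K]]
      Comp_assoc[OF r(1) lH(1) kH(1)] r(2) Comp_Ident[OF kH(1)] by simp
  then show "t = Zero A (Dom A k) W"
    using Comp_assoc[OF r(1) lH(1) t(1)] Comp_Ident[OF t(1)] lH(2) Zero_Comp[OF r(1)]
      Hom_objs[OF t(1)] by simp
qed

end


section \<open>Exactness of additive cofunctors\<close>

context preadditive_category begin

lemma F_comm_group: "additive_cofunctor A F \<Longrightarrow> X \<in> Obj A \<Longrightarrow> comm_group (Fobj F X)"
  by (simp add: additive_cofunctor_def)

lemma F_group_hom:
  assumes "additive_cofunctor A F" "f \<in> Hom A X Y"
  shows "group_hom (Fobj F Y) (Fobj F X) (Farr F f)"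
proof -
  have "group (Fobj F X)" "group (Fobj F Y)"
    using F_comm_group[OF assms(1)] Hom_objs[OF assms(2)] by (auto simp: comm_group_def)
  then show ?thesis
    using assms by (auto simp: group_hom_def group_hom_axioms_def additive_cofunctor_def)
qed

lemma F_closed:
  assumes "additive_cofunctor A F" "f \<in> Hom A X Y" "y \<in> carrier (Fobj F Y)"
  shows "Farr F f y \<in> carrier (Fobj F X)"
  using group_hom.hom_closed[OF F_group_hom[OF assms(1,2)] assms(3)] .

lemma F_Comp:
  assumes "additive_cofunctor A F" "f \<in> Hom A X Y" "g \<in> Hom A Y Z" "z \<in> carrier (Fobj F Z)"
  shows "Farr F (g \<cdot> f) z = Farr F f (Farr F g z)"
  using assms unfolding additive_cofunctor_def by blast

lemma F_Plus:
  assumes "additive_cofunctor A F" "f \<in> Hom A X Y" "g \<in> Hom A X Y" "y \<in> carrier (Fobj F Y)"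
  shows "Farr F (Plus A f g) y = Farr F f y \<otimes>\<^bsub>Fobj F X\<^esub> Farr F g y"
  using assms unfolding additive_cofunctor_def by blast

text \<open>The image lies in the kernel automatically, because \<open>p \<cdot> i\<close> is zero
  and \<open>F\<close> sends zero arrows to trivial maps; only the other inclusion remains.\<close>

lemma F_exact_iff:
  assumes F: "additive_cofunctor A F" and i: "i \<in> Hom A X Y" and p: "p \<in> Hom A Y Z"
    and z: "p \<cdot> i = Zero A X Z"
  shows "F_exact A F i p \<longleftrightarrow>
    (\<forall>y\<in>carrier (Fobj F Y). Farr F i y = \<one>\<^bsub>Fobj F X\<^esub> \<longrightarrow>
      (\<exists>z\<in>carrier (Fobj F Z). y = Farr F p z))"
proof -
  note gi = F_group_hom[OF F i] and gp = F_group_hom[OF F p]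
  have "group (Fobj F X)" "Farr F i \<in> hom (Fobj F Y) (Fobj F X)"
    using gi by (auto simp: group_hom_def group_hom_axioms_def)
  then have "F_exact A F i p \<longleftrightarrow>
      kernel (Fobj F Y) (Fobj F X) (Farr F i) = Farr F p ` carrier (Fobj F Z)"
    using HomD[OF i] HomD[OF p] gp unfolding F_exact_def by simp
  moreover have "Farr F p ` carrier (Fobj F Z) \<subseteq> kernel (Fobj F Y) (Fobj F X) (Farr F i)"
    using F_closed[OF F p] F_Comp[OF F i p] F_Zero[OF F] Hom_objs[OF i] Hom_objs[OF p] z
    by (auto simp: kernel_def)
  ultimately show ?thesis unfolding kernel_def by blast
qed

lemma F_inj_iff:
  assumes F: "additive_cofunctor A F" and p: "p \<in> Hom A Y Z"
  shows "inj_on (Farr F p) (carrier (Fobj F Z)) \<longleftrightarrow>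
    (\<forall>z\<in>carrier (Fobj F Z). Farr F p z = \<one>\<^bsub>Fobj F Y\<^esub> \<longrightarrow> z = \<one>\<^bsub>Fobj F Z\<^esub>)"
  using group_hom.inj_on_one_iff[OF F_group_hom[OF assms]] by blast

lemma F_exact_right_trivial:
  assumes F: "additive_cofunctor A F" and i: "i \<in> Hom A X Y" and ex: "F_exact A F i p"
    and "trivial_group (Fobj F X)"
  shows "F_right_exact A F i p"
proof -
  interpret i: group_hom "Fobj F Y" "Fobj F X" "Farr F i" using F_group_hom[OF F i] .
  have "carrier (Fobj F X) = {\<one>\<^bsub>Fobj F X\<^esub>}" using assms(4) by (simp add: trivial_group_def)
  then have "Farr F i ` carrier (Fobj F Y) = carrier (Fobj F X)"
    using i.hom_closed i.hom_one i.G.one_closed by (metis image_subsetI subset_singletonD image_is_empty empty_iff)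
  then show ?thesis using ex HomD[OF i] by (simp add: F_right_exact_def)
qed

lemma F_right_exact_trivial:
  assumes F: "additive_cofunctor A F" and i: "i \<in> Hom A X Y" and ex: "F_right_exact A F i p"
    and "trivial_group (Fobj F Y)"
  shows "trivial_group (Fobj F X)"
proof -
  interpret i: group_hom "Fobj F Y" "Fobj F X" "Farr F i" using F_group_hom[OF F i] .
  have "carrier (Fobj F X) = Farr F i ` {\<one>\<^bsub>Fobj F Y\<^esub>}"
    using ex HomD[OF i] assms(4) by (simp add: F_right_exact_def trivial_group_def)
  then show ?thesis by (simp add: trivial_group_def i.H.is_group)
qed

text \<open>Lets \<open>F_exact_iff\<close> apply to the represented functors that define
  properness.\<close>

lemma Hom_cofunctor_additive:
  assumes "W \<in> Obj A"
  shows "additive_cofunctor A (Hom_cofunctor A W)"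
proof -
  have "(\<lambda>g. g \<cdot> f) \<in> hom (Hom_group A Y W) (Hom_group A X W)" if f: "f \<in> Hom A X Y" for f X Y
    using Comp_closed[OF f] Plus_Comp[OF f] by (intro homI) (simp_all add: Hom_group_def)
  then show ?thesis
    using Hom_comm_group[OF _ assms] Comp_Ident Comp_assoc Comp_Plus
    unfolding additive_cofunctor_def Hom_cofunctor_def
    by (auto simp: Hom_group_def)
qed

lemma Hom_exact_iff:
  assumes "W \<in> Obj A" "i \<in> Hom A X Y" "p \<in> Hom A Y Z" "p \<cdot> i = Zero A X Z"
  shows "F_exact A (Hom_cofunctor A W) i p \<longleftrightarrow>
    (\<forall>f\<in>Hom A Y W. f \<cdot> i = Zero A X W \<longrightarrow> (\<exists>g\<in>Hom A Z W. f = g \<cdot> p))"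
  using F_exact_iff[OF Hom_cofunctor_additive[OF assms(1)] assms(2-4)]
  by (simp add: Hom_cofunctor_def Hom_group_def)

lemma Hom_exact_short_exact_extend:
  assumes "Hom_exact_short_exact A V i p" "i \<in> Hom A X Y" "W \<in> V" "f \<in> Hom A X W"
  obtains g where "g \<in> Hom A Y W" "f = g \<cdot> i"
proof -
  have "F_right_exact A (Hom_cofunctor A W) i p"
    using assms(1,3) unfolding Hom_exact_short_exact_def by blast
  then have "(\<lambda>g. g \<cdot> i) ` Hom A Y W = Hom A X W" using HomD[OF assms(2)]
    by (simp add: F_right_exact_def Hom_cofunctor_def Hom_group_def)
  then show thesis using assms(4) that by blast
qed

end

section \<open>\<open>Hom(-,V)\<close>-exact short exact sequences cut out of proper
  coresolutions\<close>

context abelian_category begin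

text \<open>Represented functors are left exact on any short exact sequence: \<open>p\<close> is a
  cokernel of \<open>i\<close> and an epi. What remains to be supplied is the extension of arrows
  into \<open>V\<close> along \<open>i\<close>.\<close>

lemma Hom_exact_short_exactI:
  assumes se: "short_exact A i p" and i: "i \<in> Hom A X Y" and V: "V \<subseteq> Obj A"
    and ext: "\<And>W f. W \<in> V \<Longrightarrow> f \<in> Hom A X W \<Longrightarrow> \<exists>g\<in>Hom A Y W. f = g \<cdot> i"
  shows "Hom_exact_short_exact A V i p"
  unfolding Hom_exact_short_exact_def
proof (intro conjI ballI)
  show "short_exact A i p" by fact
  note c = short_exact_kernel(2)[OF se]
  define Z where "Z = Cod A p"
  have p: "p \<in> Hom A Y Z" "p \<cdot> i = Zero A X Z" "epi_arr A p"
    using cokernel_arrD[OF c i] by (auto simp: Z_def)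
  fix W assume "W \<in> V"
  then have W: "W \<in> Obj A" using V by blast
  have ex: "F_exact A (Hom_cofunctor A W) i p"
    unfolding Hom_exact_iff[OF W i p(1,2)] using cokernel_desc[OF c i] unfolding Z_def by metis
  have "inj_on (\<lambda>g. g \<cdot> p) (Hom A Z W)"
    by (rule inj_onI) (rule epi_cancel[OF p(3,1)])
  then show "F_left_exact A (Hom_cofunctor A W) i p"
    using ex by (simp add: F_left_exact_def Hom_cofunctor_def Hom_group_def Z_def)
  have "(\<lambda>g. g \<cdot> i) ` Hom A Y W = Hom A X W"
    using ext[OF \<open>W \<in> V\<close>] Comp_closed[OF i] by blast
  then show "F_right_exact A (Hom_cofunctor A W) i p"
    using ex HomD[OF i] by (simp add: F_right_exact_def Hom_cofunctor_def Hom_group_def)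
qed

lemma proper_coresolution_extend:
  assumes "proper_coresolution A V M J" "W \<in> V" "f \<in> Hom A M W"
  shows "\<exists>g\<in>Hom A (term_at J 0) W. f = g \<cdot> augm J"
proof -
  have aug: "augm J \<in> Hom A M (term_at J 0)"
    and r: "F_right_exact A (Hom_cofunctor A W) (augm J) (diff_at J 0)"
    using assms by (auto simp: proper_coresolution_def)
  have "(\<lambda>g. g \<cdot> augm J) ` Hom A (term_at J 0) W = Hom A M W" using HomD[OF aug] r
    by (simp add: F_right_exact_def Hom_cofunctor_def Hom_group_def)
  then show ?thesis using assms(3) by blast
qed

text \<open>This is the test sequence for right exactness: its middle term lies in \<open>V\<close>,
  and its last term is an abstract cokernel.\<close>

lemma augm_Hom_exact:
  assumes P: "proper_coresolution A V M J" and V: "V \<subseteq> Obj A"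
  obtains c where "Hom_exact_short_exact A V (augm J) c"
proof -
  have aug: "augm J \<in> Hom A M (term_at J 0)" "mono_arr A (augm J)"
    using P by (auto simp: proper_coresolution_def)
  obtain c where c: "cokernel_arr A c (augm J)" using cokernel_exists HomD[OF aug(1)] by blast
  show thesis
    using that Hom_exact_short_exactI[OF short_exact_mono_cokernel[OF aug(2,1) c] aug(1) V]
      proper_coresolution_extend[OF P] by blast
qed

text \<open>A mono reflects zero arrows, so \<open>q\<close> and \<open>k \<cdot> q\<close> kill the
  same arrows. This passes from a differential to its corestriction.\<close>

lemma kernel_mono_Comp:
  assumes "kernel_arr A m (k \<cdot> q)" "mono_arr A k" "q \<in> Hom A X Y" "k \<in> Hom A Y Z"
  shows "kernel_arr A m q"
proof -
  have kq: "k \<cdot> q \<in> Hom A X Z" using Comp_closed[OF assms(3,4)] .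
  note m = kernel_arrD[OF assms(1) kq]
  have iff: "q \<cdot> h = Zero A U Y \<longleftrightarrow> (k \<cdot> q) \<cdot> h = Zero A U Z" if h: "h \<in> Hom A U X" for h U
    using mono_Zero[OF assms(2,4) Comp_closed[OF h assms(3)]] Comp_Zero[OF assms(4)]
      Comp_assoc[OF h assms(3,4)] Hom_objs[OF h] by metis
  show ?thesis
    by (rule kernel_arrI[OF assms(3) m(1,3)])
      (use iff m kernel_lift[OF assms(1) kq] in \<open>metis\<close>)+
qed

text \<open>The middle term is \<open>term_at J (n - 1)\<close>: the differential leaving it
  corestricts to an epi \<open>q\<close> onto the kernel \<open>T\<close> of the next one, and
  \<open>m\<close> is the kernel of \<open>q\<close>. For \<open>n = 1\<close> the augmentation
  serves as \<open>m\<close>, so the sequence starts at \<open>M\<close> itself.\<close>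

lemma cosyzygy_sequence:
  assumes "cosyzygy A V n M T" "n \<ge> 1" and V: "V \<subseteq> Obj A"
  obtains m q W where "Hom_exact_short_exact A V m q" "q \<in> Hom A W T" "W \<in> V"
    "n = 1 \<Longrightarrow> m \<in> Hom A M W"
proof -
  obtain J k where P: "proper_coresolution A V M J" and k: "kernel_arr A k (diff_at J n)"
    and T: "Dom A k = T"
    using assms(1) by (auto simp: cosyzygy_def special_proper_coresolution_def)
  let ?t = "term_at J" and ?d = "diff_at J"
  have t: "?t j \<in> V" and d: "?d j \<in> Hom A (?t j) (?t (Suc j))"
    and ex: "exact_at A (?d j) (?d (Suc j))"
    and aug: "augm J \<in> Hom A M (?t 0)" "mono_arr A (augm J)" "exact_at A (augm J) (?d 0)" for j
    using P by (auto simp: proper_coresolution_def)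
  have corestrict: "\<exists>q\<in>Hom A (?t j) (Dom A k). k \<cdot> q = ?d j \<and> epi_arr A q"
    if "kernel_arr A k (?d (Suc j))" for k j
    using kernel_lift[OF that d d exact_at_Comp[OF ex d d]]
      exact_at_corestriction_epi[OF ex d d that] by metis
  obtain j where n: "n = Suc j" using assms(2) by (cases n) auto
  obtain q where q: "q \<in> Hom A (?t j) T" "k \<cdot> q = ?d j" "epi_arr A q"
    using corestrict k n T by blast
  have kH: "k \<in> Hom A T (?t n)" "mono_arr A k" using kernel_arrD[OF k d] T by auto
  have kq: "kernel_arr A m q" if "kernel_arr A m (?d j)" for m
    using kernel_mono_Comp[OF _ kH(2) q(1) kH(1)] that q(2) by simp
  show thesis
  proof (cases j)
    case 0
    have "kernel_arr A (augm J) (?d j)" using exact_at_mono_kernel[OF aug(3,2,1) d] 0 by simp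
    then have se: "short_exact A (augm J) q" using short_exact_epi_kernel[OF q(3,1) kq] by blast
    have "Hom_exact_short_exact A V (augm J) q"
      using Hom_exact_short_exactI[OF se aug(1) V] proper_coresolution_extend[OF P] by blast
    then show thesis using that[OF _ q(1) t] aug(1) 0 by simp
  next
    case (Suc l)
    obtain m where m: "kernel_arr A m (?d j)" using kernel_exists HomD[OF d] by blast
    note mH = kernel_arrD[OF m d]
    obtain q' where q': "q' \<in> Hom A (?t l) (Dom A m)" "m \<cdot> q' = ?d l" "epi_arr A q'"
      using corestrict m Suc by blast
    \<comment> \<open>\<open>b\<close> is the arrow before \<open>?d l\<close> in the augmented
      complex: the augmentation if \<open>l = 0\<close>, the previous differential
      otherwise.\<close>
    obtain b B where b: "b \<in> Hom A B (?t l)" "exact_at A b (?d l)"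
      "\<And>W. W \<in> V \<Longrightarrow> F_exact A (Hom_cofunctor A W) b (?d l)"
    proof (cases l)
      case 0
      then show thesis using that[of "augm J" M] aug P
        by (auto simp: proper_coresolution_def F_right_exact_def)
    next
      case (Suc l')
      then show thesis using that[of "?d l'" "?t l'"] d[of l'] ex[of l'] P
        by (auto simp: proper_coresolution_def)
    qed
    have db: "?d l \<cdot> b = Zero A B (?t j)" using exact_at_Comp[OF b(2,1) d] Suc by simp
    have q'b: "q' \<cdot> b = Zero A B (Dom A m)"
      using mono_Zero[OF mH(3,1) Comp_closed[OF b(1) q'(1)]] Comp_assoc[OF b(1) q'(1) mH(1)]
        db q'(2) by simp
    have "Hom_exact_short_exact A V m q"
    proof (rule Hom_exact_short_exactI[OF short_exact_epi_kernel[OF q(3,1) kq[OF m]] mH(1) V])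
      fix W f assume W: "W \<in> V" and f: "f \<in> Hom A (Dom A m) W"
      have WO: "W \<in> Obj A" using W V by blast
      \<comment> \<open>Properness at \<open>?t l\<close> turns \<open>f \<cdot> q'\<close>, which
        kills \<open>b\<close>, into \<open>g \<cdot> ?d l\<close>, that is,
        \<open>g \<cdot> m \<cdot> q'\<close>. Cancelling the epi \<open>q'\<close> gives the
        extension \<open>g\<close> of \<open>f\<close>.\<close>
      have "(f \<cdot> q') \<cdot> b = Zero A B W"
        using Comp_assoc[OF b(1) q'(1) f] q'b Comp_Zero[OF f] Hom_objs[OF b(1)] by simp
      then obtain g where g: "g \<in> Hom A (?t j) W" "f \<cdot> q' = g \<cdot> ?d l"
        using b(3)[OF W] Hom_exact_iff[OF WO b(1) d exact_at_Comp[OF b(2,1) d]]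
          Comp_closed[OF q'(1) f] Suc by auto
      have "f = g \<cdot> m"
        using epi_cancel[OF q'(3,1) f Comp_closed[OF mH(1) g(1)]] g(2) q'(2)
          Comp_assoc[OF q'(1) mH(1) g(1)] by simp
      then show "\<exists>g\<in>Hom A (?t j) W. f = g \<cdot> m" using g(1) by blast
    qed
    then show thesis using that[OF _ q(1) t] Suc n by simp
  qed
qed

end

section \<open>Exactness of the stable functor\<close>

locale stabilization = abelian_category A for A :: "('o, 'm) precategory" (structure) +
  fixes F :: "('o, 'm, 'g) cofunctor" and V :: "'o set" and I :: "'o \<Rightarrow> ('o, 'm) coresolution"
  assumes F: "additive_cofunctor A F" and V: "V \<subseteq> Obj A"
    and P: "M \<in> Obj A \<Longrightarrow> proper_coresolution A V M (I M)"
begin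

abbreviation R :: "'o \<Rightarrow> 'g set" where "R M \<equiv> rho_image F (I M)"

abbreviation S :: "('o, 'm, 'g set) cofunctor" where "S \<equiv> stable_functor A I F"

lemma S: "additive_cofunctor A S"
  using stable_functor_additive[OF F P] .

lemma augm_closed: "M \<in> Obj A \<Longrightarrow> augm (I M) \<in> Hom A M (term_at (I M) 0)"
  and term_closed: "M \<in> Obj A \<Longrightarrow> term_at (I M) 0 \<in> V"
  using P by (auto simp: proper_coresolution_def)

lemma R_eq: "M \<in> Obj A \<Longrightarrow> R M = Farr F (augm (I M)) ` carrier (Fobj F (term_at (I M) 0))"
  using rho_image_eq[OF F P] .

lemma R_subgroup: "M \<in> Obj A \<Longrightarrow> subgroup (R M) (Fobj F M)"
  using group_hom.img_is_subgroup[OF F_group_hom[OF F augm_closed]] R_eq by simp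

lemma R_natural: "f \<in> Hom A M N \<Longrightarrow> x \<in> R N \<Longrightarrow> Farr F f x \<in> R M"
  using rho_image_natural[OF F P P] Hom_objs by blast

text \<open>The identity of \<open>W\<close> is an arrow into \<open>V\<close>, so it extends along
  the augmentation. The augmentation is therefore a split mono, which \<open>F\<close> sends to a
  surjection.\<close>

lemma R_of_V:
  assumes "W \<in> V"
  shows "R W = carrier (Fobj F W)"
proof -
  have W: "W \<in> Obj A" using assms V by blast
  obtain g where g: "g \<in> Hom A (term_at (I W) 0) W" "Ident A W = g \<cdot> augm (I W)"
    using proper_coresolution_extend[OF P[OF W] assms Ident_closed[OF W]] by blast
  have "x \<in> R W" if x: "x \<in> carrier (Fobj F W)" for x
  proof -
    have "x = Farr F (Ident A W) x" using F W x by (simp add: additive_cofunctor_def)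
    also have "\<dots> = Farr F (augm (I W)) (Farr F g x)"
      unfolding g(2) by (rule F_Comp[OF F augm_closed[OF W] g(1) x])
    finally show ?thesis using R_eq[OF W] F_closed[OF F g(1) x] by blast
  qed
  then show ?thesis using subgroup.subset[OF R_subgroup[OF W]] by blast
qed

text \<open>Together with \<open>R_V\<close> this describes \<open>R M\<close> by arbitrary arrows
  into \<open>V\<close>; here the arrow is the chosen augmentation.\<close>

lemma R_factor:
  assumes "M \<in> Obj A" "x \<in> R M"
  obtains W f y where "W \<in> V" "f \<in> Hom A M W" "y \<in> carrier (Fobj F W)" "x = Farr F f y"
  using assms R_eq augm_closed term_closed by blast

lemma R_V:
  assumes "f \<in> Hom A M W" "W \<in> V" "y \<in> carrier (Fobj F W)"
  shows "Farr F f y \<in> R M"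
  using R_natural[OF assms(1)] R_of_V[OF assms(2)] assms(3) by blast

lemma S_carrier: "carrier (Fobj S M) = (\<lambda>x. R M #>\<^bsub>Fobj F M\<^esub> x) ` carrier (Fobj F M)"
  by (auto simp: stable_functor_def FactGroup_def RCOSETS_def)

lemma S_one: "\<one>\<^bsub>Fobj S M\<^esub> = R M"
  by (simp add: stable_functor_def FactGroup_def)

lemma coset_eq_iff:
  assumes M: "M \<in> Obj A" and x: "x \<in> carrier (Fobj F M)" and y: "y \<in> carrier (Fobj F M)"
  shows "R M #>\<^bsub>Fobj F M\<^esub> x = R M #>\<^bsub>Fobj F M\<^esub> y \<longleftrightarrow> (\<exists>r\<in>R M. x = r \<otimes>\<^bsub>Fobj F M\<^esub> y)"
proof -
  interpret H: comm_group "Fobj F M" using F_comm_group[OF F M] .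
  have "R M #>\<^bsub>Fobj F M\<^esub> x = R M #>\<^bsub>Fobj F M\<^esub> y \<longleftrightarrow> x \<in> R M #>\<^bsub>Fobj F M\<^esub> y"
    using H.repr_independence[OF _ y R_subgroup[OF M]] H.rcos_self[OF x R_subgroup[OF M]] by metis
  then show ?thesis by (auto simp: r_coset_def)
qed

lemma coset_eq_one_iff:
  assumes M: "M \<in> Obj A" and x: "x \<in> carrier (Fobj F M)"
  shows "R M #>\<^bsub>Fobj F M\<^esub> x = \<one>\<^bsub>Fobj S M\<^esub> \<longleftrightarrow> x \<in> R M"
proof -
  interpret H: comm_group "Fobj F M" using F_comm_group[OF F M] .
  have "R M \<subseteq> carrier (Fobj F M)" using subgroup.subset[OF R_subgroup[OF M]] .
  then have "R M #>\<^bsub>Fobj F M\<^esub> \<one>\<^bsub>Fobj F M\<^esub> = R M" by simp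
  then show ?thesis
    using coset_eq_iff[OF M x H.one_closed] \<open>R M \<subseteq> _\<close> unfolding S_one
    by (metis H.r_one subset_iff)
qed

text \<open>The union defining \<open>Farr S f\<close> runs over a nonempty coset, and by
  \<open>R_natural\<close> all its members contribute the same coset.\<close>

lemma S_coset:
  assumes f: "f \<in> Hom A M N" and x: "x \<in> carrier (Fobj F N)"
  shows "Farr S f (R N #>\<^bsub>Fobj F N\<^esub> x) = R M #>\<^bsub>Fobj F M\<^esub> Farr F f x"
proof -
  have MN: "M \<in> Obj A" "N \<in> Obj A" using Hom_objs[OF f] by auto
  interpret N: comm_group "Fobj F N" using F_comm_group[OF F MN(2)] .
  interpret f: group_hom "Fobj F N" "Fobj F M" "Farr F f" using F_group_hom[OF F f] .
  have "R M #>\<^bsub>Fobj F M\<^esub> Farr F f z = R M #>\<^bsub>Fobj F M\<^esub> Farr F f x"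
    if z: "z \<in> R N #>\<^bsub>Fobj F N\<^esub> x" for z
  proof -
    obtain r where r: "r \<in> R N" "z = r \<otimes>\<^bsub>Fobj F N\<^esub> x" using z unfolding r_coset_def by blast
    have rc: "r \<in> carrier (Fobj F N)" using subgroup.mem_carrier[OF R_subgroup[OF MN(2)] r(1)] .
    then have "z \<in> carrier (Fobj F N)" using r(2) x by simp
    then show ?thesis
      using coset_eq_iff[OF MN(1)] f.hom_closed x R_natural[OF f r(1)] f.hom_mult[OF rc x] r(2)
      by blast
  qed
  moreover have "R N #>\<^bsub>Fobj F N\<^esub> x \<noteq> {}"
    using N.rcos_self[OF x R_subgroup[OF MN(2)]] by blast
  ultimately show ?thesis
    using HomD[OF f] by (simp add: stable_functor_def)
qed

lemma S_trivial_iff: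
  assumes "M \<in> Obj A"
  shows "trivial_group (Fobj S M) \<longleftrightarrow> R M = carrier (Fobj F M)"
proof -
  interpret H: comm_group "Fobj F M" using F_comm_group[OF F assms] .
  have "group (Fobj S M)" using F_comm_group[OF S assms] by (simp add: comm_group_def)
  then have "trivial_group (Fobj S M) \<longleftrightarrow> (\<forall>s\<in>carrier (Fobj S M). s = \<one>\<^bsub>Fobj S M\<^esub>)"
    unfolding trivial_group_def using group.is_monoid monoid.one_closed by blast
  also have "\<dots> \<longleftrightarrow> (\<forall>x\<in>carrier (Fobj F M). x \<in> R M)"
    using coset_eq_one_iff[OF assms] by (simp add: S_carrier)
  also have "\<dots> \<longleftrightarrow> R M = carrier (Fobj F M)"
    using subgroup.subset[OF R_subgroup[OF assms]] by blast
  finally show ?thesis .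
qed

lemma S_trivial_V: "W \<in> V \<Longrightarrow> trivial_group (Fobj S W)"
  using S_trivial_iff R_of_V V by blast

lemma S_inj_iff:
  assumes p: "p \<in> Hom A Y Z"
  shows "inj_on (Farr S p) (carrier (Fobj S Z)) \<longleftrightarrow>
    (\<forall>z\<in>carrier (Fobj F Z). Farr F p z \<in> R Y \<longrightarrow> z \<in> R Z)"
  unfolding F_inj_iff[OF S p] unfolding S_carrier
  using S_coset[OF p] coset_eq_one_iff F_closed[OF F p] Hom_objs[OF p] by auto

text \<open>If \<open>F(i)x\<close> comes from \<open>F(W)\<close> along \<open>f = g \<cdot> i\<close>, correcting \<open>x\<close> by an element coming from
  \<open>F(W)\<close> along \<open>g\<close> moves it into the kernel of \<open>F(i)\<close>.\<close>

lemma stable_half_exact: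
  assumes "half_Hom_exact A V F"
  shows "half_Hom_exact A V S"
  unfolding half_Hom_exact_def
proof (intro allI impI)
  fix i p assume H: "Hom_exact_short_exact A V i p"
  then have se: "short_exact A i p" by (simp add: Hom_exact_short_exact_def)
  obtain X Y Z where i: "i \<in> Hom A X Y" and p: "p \<in> Hom A Y Z" using short_exact_Hom[OF se] .
  have pi: "p \<cdot> i = Zero A X Z"
    using kernel_arrD(2)[OF short_exact_kernel(1)[OF se] p] HomD[OF i] by simp
  have X: "X \<in> Obj A" and Y: "Y \<in> Obj A" using Hom_objs[OF i] by auto
  interpret Y: comm_group "Fobj F Y" using F_comm_group[OF F Y] .
  interpret i: group_hom "Fobj F Y" "Fobj F X" "Farr F i" using F_group_hom[OF F i] .
  have exF: "\<exists>z\<in>carrier (Fobj F Z). y = Farr F p z"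
    if "y \<in> carrier (Fobj F Y)" "Farr F i y = \<one>\<^bsub>Fobj F X\<^esub>" for y
    using assms H that F_exact_iff[OF F i p pi] unfolding half_Hom_exact_def by blast
  show "F_exact A S i p" unfolding F_exact_iff[OF S i p pi]
  proof (intro ballI impI)
    fix s assume s: "s \<in> carrier (Fobj S Y)" "Farr S i s = \<one>\<^bsub>Fobj S X\<^esub>"
    then obtain x where x: "x \<in> carrier (Fobj F Y)" "s = R Y #>\<^bsub>Fobj F Y\<^esub> x"
      unfolding S_carrier by blast
    have "Farr F i x \<in> R X"
      using s(2) S_coset[OF i x(1)] coset_eq_one_iff[OF X] F_closed[OF F i x(1)] x(2) by simp
    then obtain W f w where f: "W \<in> V" "f \<in> Hom A X W" "w \<in> carrier (Fobj F W)"
      "Farr F i x = Farr F f w" using R_factor[OF X] by blast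
    obtain g where g: "g \<in> Hom A Y W" "f = g \<cdot> i"
      using Hom_exact_short_exact_extend[OF H i f(1,2)] .
    define r where "r = Farr F g w"
    have r: "r \<in> R Y" "r \<in> carrier (Fobj F Y)" "Farr F i r = Farr F i x"
      using R_V[OF g(1) f(1,3)] F_closed[OF F g(1) f(3)] F_Comp[OF F i g(1) f(3)] f(4) g(2)
      by (auto simp: r_def)
    have "Farr F i (inv\<^bsub>Fobj F Y\<^esub> r \<otimes>\<^bsub>Fobj F Y\<^esub> x) = \<one>\<^bsub>Fobj F X\<^esub>" using r x by simp
    then obtain z where z: "z \<in> carrier (Fobj F Z)"
      "inv\<^bsub>Fobj F Y\<^esub> r \<otimes>\<^bsub>Fobj F Y\<^esub> x = Farr F p z"
      using exF r x by blast
    \<comment> \<open>The correction \<open>r\<close> lies in \<open>R Y\<close>, so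
      \<open>s\<close> is also the coset of \<open>Farr F p z\<close>.\<close>
    have "x = r \<otimes>\<^bsub>Fobj F Y\<^esub> Farr F p z"
      unfolding z(2)[symmetric] using r x by (simp add: Y.m_assoc[symmetric])
    then have "s = Farr S p (R Z #>\<^bsub>Fobj F Z\<^esub> z)"
      using coset_eq_iff[OF Y x(1) F_closed[OF F p z(1)]] r(1) x(2) S_coset[OF p z(1)] by auto
    then show "\<exists>t\<in>carrier (Fobj S Z). s = Farr S p t" using z(1) unfolding S_carrier by blast
  qed
qed

text \<open>On the augmentation sequence, right exactness maps the trivial group \<open>S\<close> of
  a term in \<open>V\<close> onto \<open>S\<close> of \<open>M\<close>.\<close>

lemma stable_right_exact_imp_zero:
  assumes "right_Hom_exact A V S"
  shows "zero_cofunctor A S"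
  unfolding zero_cofunctor_def
proof
  fix M assume M: "M \<in> Obj A"
  obtain c where "Hom_exact_short_exact A V (augm (I M)) c" using augm_Hom_exact[OF P[OF M] V] .
  then have "F_right_exact A S (augm (I M)) c" using assms by (simp add: right_Hom_exact_def)
  then show "trivial_group (Fobj S M)"
    using F_right_exact_trivial[OF S augm_closed[OF M]] S_trivial_V[OF term_closed[OF M]] by blast
qed

text \<open>Surjectivity of \<open>F\<close> on the augmentation says precisely that
  \<open>R M\<close> is all of \<open>F M\<close>.\<close>

lemma right_exact_imp_stable_zero:
  assumes "right_Hom_exact A V F"
  shows "zero_cofunctor A S"
  unfolding zero_cofunctor_def
proof
  fix M assume M: "M \<in> Obj A"
  obtain c where "Hom_exact_short_exact A V (augm (I M)) c" using augm_Hom_exact[OF P[OF M] V] .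
  then have "F_right_exact A F (augm (I M)) c" using assms by (simp add: right_Hom_exact_def)
  then show "trivial_group (Fobj S M)"
    unfolding S_trivial_iff[OF M] R_eq[OF M] F_right_exact_def
    using HomD[OF augm_closed[OF M]] by simp
qed

text \<open>For \<open>S\<close>, half exactness suffices since the last group is trivial. For
  \<open>F\<close>, each \<open>x\<close> comes from some \<open>w\<close> along \<open>f\<close>
  into \<open>V\<close>; extending \<open>f\<close> to \<open>g\<close> along \<open>i\<close> makes
  \<open>Farr F g w\<close> a preimage of \<open>x\<close>.\<close>

lemma stable_zero_imp_right_exact:
  assumes half: "half_Hom_exact A V F" and zero: "zero_cofunctor A S"
  shows "right_Hom_exact A V F" "right_Hom_exact A V S"
  unfolding right_Hom_exact_def
proof (safe)
  fix i p assume H: "Hom_exact_short_exact A V i p"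
  then have se: "short_exact A i p" by (simp add: Hom_exact_short_exact_def)
  obtain X Y Z where i: "i \<in> Hom A X Y" and p: "p \<in> Hom A Y Z" using short_exact_Hom[OF se] .
  have X: "X \<in> Obj A" using Hom_objs[OF i] by auto
  have triv: "trivial_group (Fobj S X)" using zero X by (simp add: zero_cofunctor_def)
  show "F_right_exact A S i p"
    using F_exact_right_trivial[OF S i _ triv] stable_half_exact[OF half] H
    by (simp add: half_Hom_exact_def)
  have "x \<in> Farr F i ` carrier (Fobj F Y)" if "x \<in> carrier (Fobj F X)" for x
  proof -
    have "x \<in> R X" using that triv S_trivial_iff[OF X] by simp
    then obtain W f w where f: "W \<in> V" "f \<in> Hom A X W" "w \<in> carrier (Fobj F W)" "x = Farr F f w"
      using R_factor[OF X] by blast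
    obtain g where g: "g \<in> Hom A Y W" "f = g \<cdot> i"
      using Hom_exact_short_exact_extend[OF H i f(1,2)] .
    show ?thesis using F_Comp[OF F i g(1) f(3)] F_closed[OF F g(1) f(3)] f(4) g(2) by simp
  qed
  then have "Farr F i ` carrier (Fobj F Y) = carrier (Fobj F X)"
    using F_closed[OF F i] by blast
  then show "F_right_exact A F i p"
    using half H HomD[OF i] by (simp add: half_Hom_exact_def F_right_exact_def)
qed

section \<open>Left exactness of the stable functor and vanishing on cosyzygies\<close>

lemma stable_left_exact_imp_cosyzygy_trivial:
  assumes "left_Hom_exact A V S" "cosyzygy A V n M T" "n \<ge> 1"
  shows "trivial_group (Fobj S T)"
proof -
  obtain m q W where H: "Hom_exact_short_exact A V m q" and q: "q \<in> Hom A W T" and W: "W \<in> V"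
    using cosyzygy_sequence[OF assms(2,3) V] by metis
  have T: "T \<in> Obj A" using Hom_objs[OF q] by blast
  have "inj_on (Farr S q) (carrier (Fobj S T))"
    using assms(1) H HomD[OF q] by (auto simp: left_Hom_exact_def F_left_exact_def)
  \<comment> \<open>\<open>Farr F q z\<close> lies in \<open>F W\<close>, which is
    \<open>R W\<close>, so injectivity of \<open>Farr S q\<close> forces \<open>z\<close> into
    \<open>R T\<close>.\<close>
  then have "z \<in> R T" if "z \<in> carrier (Fobj F T)" for z
    using S_inj_iff[OF q] that F_closed[OF F q that] R_of_V[OF W] by blast
  then show ?thesis
    unfolding S_trivial_iff[OF T] using subgroup.subset[OF R_subgroup[OF T]] by blast
qed

text \<open>Extend \<open>e\<close> to \<open>a : Y \<rightarrow> W\<close>, which induces \<open>\<delta> : Z \<rightarrow> T\<close>. Every arrow from \<open>Y\<close> to \<open>V\<close> is of the form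
  \<open>g \<cdot> a + h \<cdot> p\<close>: this is the \<open>Hom(-,V)\<close>-exactness of the mapping cone \<open>0 \<rightarrow> Y \<rightarrow> W \<oplus> Z \<rightarrow> T \<rightarrow> 0\<close>.\<close>

lemma stable_inj_if_cosyzygy_trivial:
  assumes left: "left_Hom_exact A V F"
    and H: "Hom_exact_short_exact A V i p" and i: "i \<in> Hom A X Y" and p: "p \<in> Hom A Y Z"
    and H': "Hom_exact_short_exact A V e q" and e: "e \<in> Hom A X W" and q: "q \<in> Hom A W T"
    and W: "W \<in> V" and triv: "trivial_group (Fobj S T)"
    and z: "z \<in> carrier (Fobj F Z)" "Farr F p z \<in> R Y"
  shows "z \<in> R Z"
proof -
  have obj: "X \<in> Obj A" "Y \<in> Obj A" "Z \<in> Obj A" "T \<in> Obj A"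
    using Hom_objs[OF i] Hom_objs[OF p] Hom_objs[OF q] by auto
  have se: "short_exact A i p" "short_exact A e q"
    using H H' by (auto simp: Hom_exact_short_exact_def)
  have c: "cokernel_arr A p i" and Z: "Cod A p = Z"
    using short_exact_kernel(2)[OF se(1)] HomD[OF p] by auto
  have pi: "p \<cdot> i = Zero A X Z" and qe: "q \<cdot> e = Zero A X T"
    using cokernel_arrD(2)[OF c i] Z cokernel_arrD(2)[OF short_exact_kernel(2)[OF se(2)] e]
      HomD[OF q] by auto
  obtain W' f y where f: "W' \<in> V" "f \<in> Hom A Y W'" "y \<in> carrier (Fobj F W')"
    "Farr F p z = Farr F f y" using R_factor[OF obj(2) z(2)] .
  obtain a where a: "a \<in> Hom A Y W" "e = a \<cdot> i"
    using Hom_exact_short_exact_extend[OF H i W e] .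
  obtain g where g: "g \<in> Hom A W W'" "f \<cdot> i = g \<cdot> e"
    using Hom_exact_short_exact_extend[OF H' e f(1) Comp_closed[OF i f(2)]] .
  have ga: "g \<cdot> a \<in> Hom A Y W'" using Comp_closed[OF a(1) g(1)] .
  \<comment> \<open>Since \<open>f\<close> and \<open>g \<cdot> a\<close> agree on \<open>i\<close>,
    their difference \<open>t\<close> kills \<open>i\<close> and descends to \<open>h\<close> on
    \<open>Z\<close>.\<close>
  obtain t where t: "t \<in> Hom A Y W'" "f = Plus A t (g \<cdot> a)" using Hom_difference[OF f(2) ga] .
  have "(g \<cdot> a) \<cdot> i = f \<cdot> i" using Comp_assoc[OF i a(1) g(1)] a(2) g(2) by simp
  then have "Plus A (t \<cdot> i) (f \<cdot> i) = f \<cdot> i" using Plus_Comp[OF i t(1) ga] t(2) by simp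
  then have "t \<cdot> i = Zero A X W'"
    using Plus_eq_right_iff[OF Comp_closed[OF i t(1)] Comp_closed[OF i f(2)]] by simp
  then obtain h where h: "h \<in> Hom A Z W'" "h \<cdot> p = t"
    using cokernel_desc[OF c i t(1)] Z by blast
  have "(q \<cdot> a) \<cdot> i = Zero A X T" using Comp_assoc[OF i a(1) q] a(2) qe by simp
  then obtain \<delta> where \<delta>: "\<delta> \<in> Hom A Z T" "\<delta> \<cdot> p = q \<cdot> a"
    using cokernel_desc[OF c i Comp_closed[OF a(1) q]] Z by blast

  interpret Z: comm_group "Fobj F Z" using F_comm_group[OF F obj(3)] .
  interpret Y: comm_group "Fobj F Y" using F_comm_group[OF F obj(2)] .
  interpret p: group_hom "Fobj F Z" "Fobj F Y" "Farr F p" using F_group_hom[OF F p] .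
  have left_p: "inj_on (Farr F p) (carrier (Fobj F Z))" and exact_q: "F_exact A F e q"
    using left H H' HomD[OF p] by (auto simp: left_Hom_exact_def F_left_exact_def)
  \<comment> \<open>The decomposition of \<open>f\<close> splits \<open>Farr F p z\<close> into
    \<open>Farr F p r\<close> and \<open>Farr F a u\<close>. Dividing \<open>z\<close> by
    \<open>r\<close>, which lies in \<open>R Z\<close>, leaves \<open>z'\<close> with
    \<open>Farr F p z' = Farr F a u\<close>.\<close>
  define u where "u = Farr F g y"
  define r where "r = Farr F h y"
  define z' where "z' = inv\<^bsub>Fobj F Z\<^esub> r \<otimes>\<^bsub>Fobj F Z\<^esub> z"
  have u: "u \<in> carrier (Fobj F W)" using F_closed[OF F g(1) f(3)] by (simp add: u_def)
  have r: "r \<in> carrier (Fobj F Z)" "r \<in> R Z"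
    using F_closed[OF F h(1) f(3)] R_V[OF h(1) f(1,3)] by (simp_all add: r_def)
  have z': "z' \<in> carrier (Fobj F Z)" using r z by (simp add: z'_def)
  have au: "Farr F a u \<in> carrier (Fobj F Y)" using F_closed[OF F a(1) u] .
  have "Farr F p z = Farr F p r \<otimes>\<^bsub>Fobj F Y\<^esub> Farr F a u"
    using f(4) F_Plus[OF F t(1) ga f(3)] t(2) F_Comp[OF F p h(1) f(3)] h(2)
      F_Comp[OF F a(1) g(1) f(3)] by (simp add: u_def r_def)
  then have pz': "Farr F p z' = Farr F a u"
    using r z au by (simp add: z'_def Y.m_assoc[symmetric])
  \<comment> \<open>As \<open>e = a \<cdot> i\<close>, \<open>Farr F e u\<close> is the image of
    \<open>z'\<close> under \<open>p \<cdot> i\<close>, hence trivial; exactness of \<open>F\<close>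
    on the cosyzygy sequence then lifts \<open>u\<close> to \<open>v\<close>.\<close>
  have "Farr F e u = Farr F (p \<cdot> i) z'"
    using F_Comp[OF F i a(1) u] a(2) F_Comp[OF F i p z'] pz' by simp
  then have "Farr F e u = \<one>\<^bsub>Fobj F X\<^esub>" using pi F_Zero[OF F obj(1,3) z'] by simp
  then obtain v where v: "v \<in> carrier (Fobj F T)" "u = Farr F q v"
    using exact_q F_exact_iff[OF F e q qe] u by blast
  \<comment> \<open>Injectivity of \<open>Farr F p\<close> identifies \<open>z'\<close> with
    \<open>Farr F \<delta> v\<close>; \<open>v\<close> lies in \<open>R T\<close> by triviality, and
    naturality carries this to \<open>R Z\<close>.\<close>
  have "Farr F p (Farr F \<delta> v) = Farr F p z'"
    using F_Comp[OF F p \<delta>(1) v(1)] \<delta>(2) F_Comp[OF F a(1) q v(1)] v(2) pz' by simp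
  then have "Farr F \<delta> v = z'"
    using left_p F_closed[OF F \<delta>(1) v(1)] z' by (auto dest: inj_onD)
  moreover have "v \<in> R T" using triv S_trivial_iff[OF obj(4)] v(1) by blast
  ultimately have "z' \<in> R Z" using R_natural[OF \<delta>(1)] by blast
  moreover have "z = r \<otimes>\<^bsub>Fobj F Z\<^esub> z'" using r z by (simp add: z'_def Z.m_assoc[symmetric])
  ultimately show ?thesis using r(2) subgroup.m_closed[OF R_subgroup[OF obj(3)]] by simp
qed

text \<open>Half exactness is inherited from \<open>F\<close>. Injectivity comes from comparison
  with a cosyzygy sequence of the left-hand term \<open>X\<close>, for which a single cosyzygy of
  each object suffices.\<close>

lemma stable_left_exact_if_cosyzygy_trivial:
  assumes left: "left_Hom_exact A V F"
    and cosyz: "\<And>M. M \<in> Obj A \<Longrightarrow> \<exists>T. cosyzygy A V 1 M T \<and> trivial_group (Fobj S T)"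
  shows "left_Hom_exact A V S"
  unfolding left_Hom_exact_def
proof (intro allI impI)
  fix i p assume H: "Hom_exact_short_exact A V i p"
  then have se: "short_exact A i p" by (simp add: Hom_exact_short_exact_def)
  obtain X Y Z where i: "i \<in> Hom A X Y" and p: "p \<in> Hom A Y Z" using short_exact_Hom[OF se] .
  obtain T where T: "cosyzygy A V 1 X T" "trivial_group (Fobj S T)"
    using cosyz Hom_objs[OF i] by blast
  obtain e q W where e: "Hom_exact_short_exact A V e q" "q \<in> Hom A W T" "W \<in> V" "e \<in> Hom A X W"
    using cosyzygy_sequence[OF T(1) _ V] by auto
  have "inj_on (Farr S p) (carrier (Fobj S Z))"
    unfolding S_inj_iff[OF p]
    using stable_inj_if_cosyzygy_trivial[OF left H i p e(1,4,2,3) T(2)] by blast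
  moreover have "half_Hom_exact A V F"
    using left by (simp add: left_Hom_exact_def half_Hom_exact_def F_left_exact_def)
  then have "F_exact A S i p" using stable_half_exact H by (simp add: half_Hom_exact_def)
  ultimately show "F_left_exact A S i p" using HomD[OF p] by (simp add: F_left_exact_def)
qed

end

text \<open>\<open>I\<close> and \<open>\<Theta>\<close> are independent choices: each
  \<open>\<Theta> n M\<close> may come from its own special coresolution, unrelated to
  \<open>I M\<close>.\<close>

theorem theorem1:
  fixes A :: "('o, 'm) precategory"
    and F :: "('o, 'm, 'g) cofunctor"
    and V :: "'o set"
    and I :: "'o \<Rightarrow> ('o, 'm) coresolution"
    and \<Theta> :: "nat \<Rightarrow> 'o \<Rightarrow> 'o"
  assumes "abelian_category A"
    and "additive_cofunctor A F"
    and "additive_subcategory A V"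
    and "special_preenveloping A V"
    and "\<And>M. M \<in> Obj A \<Longrightarrow> proper_coresolution A V M (I M)"
    and "\<And>M n. M \<in> Obj A \<Longrightarrow> n \<ge> 1 \<Longrightarrow> cosyzygy A V n M (\<Theta> n M)"
  shows "(half_Hom_exact A V F \<longrightarrow>
            half_Hom_exact A V (stable_functor A I F) \<and>
            (right_Hom_exact A V (stable_functor A I F) \<longleftrightarrow>
               zero_cofunctor A (stable_functor A I F)) \<and>
            (zero_cofunctor A (stable_functor A I F) \<longleftrightarrow> right_Hom_exact A V F)) \<and>
         (left_Hom_exact A V F \<longrightarrow>
            (left_Hom_exact A V (stable_functor A I F) \<longleftrightarrow>
               (\<forall>M\<in>Obj A. \<forall>n\<ge>1. trivial_group (Fobj (stable_functor A I F) (\<Theta> n M)))) \<and>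
            ((\<forall>M\<in>Obj A. \<forall>n\<ge>1. trivial_group (Fobj (stable_functor A I F) (\<Theta> n M))) \<longleftrightarrow>
               (\<forall>M\<in>Obj A. trivial_group (Fobj (stable_functor A I F) (\<Theta> 1 M)))))"
proof -
  interpret abelian_category A by fact
  interpret stabilization A F V I
    using assms(2,3,5) by unfold_locales (auto simp: additive_subcategory_def)
  note cosyz = assms(6)
  let ?all = "\<forall>M\<in>Obj A. \<forall>n\<ge>1. trivial_group (Fobj S (\<Theta> n M))"
  let ?one = "\<forall>M\<in>Obj A. trivial_group (Fobj S (\<Theta> 1 M))"
  \<comment> \<open>A cycle: left exactness of \<open>S\<close> gives \<open>?all\<close>, which
    specializes to \<open>?one\<close> at \<open>n = 1\<close>, which gives left exactness
    back.\<close>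
  have "?all" if "left_Hom_exact A V S"
    using stable_left_exact_imp_cosyzygy_trivial[OF that cosyz] by blast
  moreover have "left_Hom_exact A V S" if "left_Hom_exact A V F" "?one"
    using stable_left_exact_if_cosyzygy_trivial[OF that(1)] cosyz that(2) by blast
  moreover have "?one" if "?all" using that by blast
  ultimately show ?thesis
    using stable_half_exact stable_right_exact_imp_zero right_exact_imp_stable_zero
      stable_zero_imp_right_exact by blast
qed

end
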